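(* Let $\rho_0=.7614$. For every $\beta\ge 1$ there exist a real sequence $(\varepsilon_N)$ with $\varepsilon_N\to 0$ as $N\to\infty$ and a constant $C>0$ such that the following holds for every integer $N\ge 512$ and all parameters $p_T,p_\Omega\in[0,1]$ with $\min(\mathbf{E}|T|,\mathbf{E}|\Omega|)\ge 4(\beta+1)\log N$ and $$2\sqrt{\mathbf{E}|T|\cdot\mathbf{E}|\Omega|}\;\le\;\mathbf{E}|T|+\mathbf{E}|\Omega|\;\le\;\frac{N}{\sqrt{(\beta+1)\log N}}\,\bigl(\rho_0/2+\varepsilon_N\bigr).$$ If $(T,\Omega)$ is the randomly sampled support pair, then with probability at least $1-C\log N\cdot N^{-\beta}$ all of the following hold simultaneously: (i) every $f\in\mathbb{C}^N$ supported on $T$ satisfies $\|\hat f\cdot 1_\Omega\|^2\le \|\hat f\|^2/2$; (ii) every $f\in\mathbb{C}^N$ whose discrete Fourier transform $\hat f$ is supported on $\Omega$ satisfies $\|f\cdot 1_T\|^2\le\|f\|^2/2$; (iii) consequently, there is no nonzero $f\in\mathbb{C}^N$ supported on $T$ whose discrete Fourier transform $\hat f$ is supported on $\Omega$. Moreover, for finite sample sizes, the same conclusion (with probability at least $1-C\log N\cdot N^{-\beta}$) holds for every $N\ge 512$ when the displayed upper bound on $\mathbf{E}|T|+\mathbf{E}|\Omega|$ is replaced by $$\mathbf{E}|T|+\mathbf{E}|\Omega|\le\frac{.2660\,N}{\sqrt{(\beta+1)\log N}}.$$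
   Context: Signals are vectors $f\in\mathbb{C}^N$ indexed by $\{0,\dots,N-1\}$; $\|\cdot\|$ is the Euclidean norm. The discrete Fourier transform is $\hat f(\omega)=\frac{1}{\sqrt N}\sum_{t=0}^{N-1}f(t)e^{-i2\pi\omega t/N}$, $\omega\in\{0,\dots,N-1\}$. $1_S$ is the indicator function of the set $S$, and multiplication by it is pointwise. Probability model: let $I_1(t)$, $t=0,\dots,N-1$, and $I_2(\omega)$, $\omega=0,\dots,N-1$, be two independent sequences of i.i.d. Bernoulli random variables with $\mathbf{P}(I_1(t)=1)=p_T$ and $\mathbf{P}(I_2(\omega)=1)=p_\Omega$. Set $T=\{t: I_1(t)=1\}$ and $\Omega=\{\omega: I_2(\omega)=1\}$. Thus $\mathbf{E}|T|=p_TN$ and $\mathbf{E}|\Omega|=p_\Omega N$. $\log$ is the natural logarithm. The $o(1)$ and $O(\cdot)$ of the paper are as $N\to\infty$ and are written out via $\varepsilon_N$ and $C$. *)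

theory Defs
  imports "HOL-Probability.Probability"
begin

text \<open>The space \<open>\<complex>\<^sup>N\<close>: since the dimension varies inside the statement, its vectors are
  functions on \<^typ>\<open>nat\<close> that vanish outside \<open>{0,\<dots>,N-1}\<close>.\<close>

definition signals :: "nat \<Rightarrow> (nat \<Rightarrow> complex) set" where
  "signals N = {f. \<forall>t\<ge>N. f t = 0}"

definition dft :: "nat \<Rightarrow> (nat \<Rightarrow> complex) \<Rightarrow> nat \<Rightarrow> complex" where
  "dft N f w = (if w < N then
     1 / of_real (sqrt (real N)) *
       (\<Sum>t<N. f t * exp (- \<i> * of_real (2 * pi * real w * real t / real N))) else 0)"

definition signal_norm :: "nat \<Rightarrow> (nat \<Rightarrow> complex) \<Rightarrow> real" where
  "signal_norm N f = L2_set (\<lambda>t. cmod (f t)) {..<N}"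

definition supported_on :: "(nat \<Rightarrow> complex) \<Rightarrow> nat set \<Rightarrow> bool" where
  "supported_on f S \<longleftrightarrow> (\<forall>t. t \<notin> S \<longrightarrow> f t = 0)"

definition mult_indicator :: "(nat \<Rightarrow> complex) \<Rightarrow> nat set \<Rightarrow> nat \<Rightarrow> complex" where
  "mult_indicator f S = (\<lambda>t. f t * indicator S t)"

text \<open>The joint law of the two independent sequences \<open>(I\<^sub>1, I\<^sub>2)\<close> of i.i.d. Bernoulli variables,
  with \<^const>\<open>True\<close> for the value 1. The second argument of \<^const>\<open>Pi_pmf\<close> is the value given to the
  indices outside \<open>{0,\<dots>,N-1}\<close>.\<close>

definition bernoulli_model :: "nat \<Rightarrow> real \<Rightarrow> real \<Rightarrow> ((nat \<Rightarrow> bool) \<times> (nat \<Rightarrow> bool)) pmf" where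
  "bernoulli_model N pT pW =
     pair_pmf (Pi_pmf {..<N} False (\<lambda>_. bernoulli_pmf pT))
              (Pi_pmf {..<N} False (\<lambda>_. bernoulli_pmf pW))"

definition time_set :: "nat \<Rightarrow> (nat \<Rightarrow> bool) \<times> (nat \<Rightarrow> bool) \<Rightarrow> nat set" where
  "time_set N I = {t. t < N \<and> fst I t}"

definition freq_set :: "nat \<Rightarrow> (nat \<Rightarrow> bool) \<times> (nat \<Rightarrow> bool) \<Rightarrow> nat set" where
  "freq_set N I = {w. w < N \<and> snd I w}"

definition expected_time_size :: "nat \<Rightarrow> real \<Rightarrow> real \<Rightarrow> real" where
  "expected_time_size N pT pW =
     measure_pmf.expectation (bernoulli_model N pT pW) (\<lambda>I. real (card (time_set N I)))"

definition expected_freq_size :: "nat \<Rightarrow> real \<Rightarrow> real \<Rightarrow> real" where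
  "expected_freq_size N pT pW =
     measure_pmf.expectation (bernoulli_model N pT pW) (\<lambda>I. real (card (freq_set N I)))"

definition robust_uncertainty :: "nat \<Rightarrow> nat set \<Rightarrow> nat set \<Rightarrow> bool" where
  "robust_uncertainty N T W \<longleftrightarrow>
     (\<forall>f\<in>signals N. supported_on f T \<longrightarrow>
        (signal_norm N (mult_indicator (dft N f) W))\<^sup>2 \<le> (signal_norm N (dft N f))\<^sup>2 / 2) \<and>
     (\<forall>f\<in>signals N. supported_on (dft N f) W \<longrightarrow>
        (signal_norm N (mult_indicator f T))\<^sup>2 \<le> (signal_norm N f)\<^sup>2 / 2) \<and>
     \<not> (\<exists>f\<in>signals N. f \<noteq> (\<lambda>_. 0) \<and> supported_on f T \<and> supported_on (dft N f) W)"

lemma expectation_card_Pi_bernoulli: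
  assumes "0 \<le> p" "p \<le> 1"
  shows "measure_pmf.expectation (Pi_pmf {..<N} False (\<lambda>_. bernoulli_pmf p))
           (\<lambda>I. real (card {t. t < N \<and> I t})) = p * real N"
proof -
  let ?M = "Pi_pmf {..<N} False (\<lambda>_. bernoulli_pmf p)"
  have fin: "finite (set_pmf ?M)"
  proof (rule finite_subset)
    show "set_pmf ?M \<subseteq> (\<lambda>A t. t \<in> A) ` Pow {..<N}"
    proof
      fix I assume "I \<in> set_pmf ?M"
      then have "\<forall>t. t \<notin> {..<N} \<longrightarrow> \<not> I t"
        using set_Pi_pmf_subset[of "{..<N}" False "\<lambda>_. bernoulli_pmf p"] by auto
      then have "{t. I t} \<in> Pow {..<N}" "I = (\<lambda>t. t \<in> {t. I t})" by auto
      then show "I \<in> (\<lambda>A t. t \<in> A) ` Pow {..<N}" by blast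
    qed
  qed auto
  have card: "real (card {t. t < N \<and> I t}) = (\<Sum>t<N. of_bool (I t))" for I :: "nat \<Rightarrow> bool"
  proof -
    have "{t. t < N \<and> I t} = {..<N} \<inter> {t. I t}" by auto
    then show ?thesis by simp
  qed
  have one: "measure_pmf.expectation ?M (\<lambda>I. of_bool (I t)) = p" if "t < N" for t
  proof -
    have "measure_pmf.expectation ?M (\<lambda>I. of_bool (I t)) =
          measure_pmf.expectation (map_pmf (\<lambda>I. I t) ?M) (of_bool :: bool \<Rightarrow> real)"
      by simp
    also have "map_pmf (\<lambda>I. I t) ?M = bernoulli_pmf p"
      using that by (simp add: Pi_pmf_component)
    finally show ?thesis using assms by simp
  qed
  have "measure_pmf.expectation ?M (\<lambda>I. \<Sum>t<N. of_bool (I t)) =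
        (\<Sum>t<N. measure_pmf.expectation ?M (\<lambda>I. of_bool (I t)) :: real)"
    by (intro Bochner_Integration.integral_sum integrable_measure_pmf_finite fin)
  also have "\<dots> = p * real N"
  proof -
    have "(\<Sum>t<N. measure_pmf.expectation ?M (\<lambda>I. of_bool (I t))) = (\<Sum>t<N. p)"
      by (rule sum.cong[OF refl], rule one) simp
    then show ?thesis by simp
  qed
  finally show ?thesis by (simp only: card)
qed

lemma expected_time_size_eq:
  assumes "0 \<le> pT" "pT \<le> 1"
  shows "expected_time_size N pT pW = pT * real N"
proof -
  have "expected_time_size N pT pW =
     measure_pmf.expectation (map_pmf fst (bernoulli_model N pT pW))
       (\<lambda>I. real (card {t. t < N \<and> I t}))"
    by (simp add: expected_time_size_def time_set_def)
  then show ?thesis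
    using assms by (simp add: bernoulli_model_def map_fst_pair_pmf expectation_card_Pi_bernoulli)
qed

lemma expected_freq_size_eq:
  assumes "0 \<le> pW" "pW \<le> 1"
  shows "expected_freq_size N pT pW = pW * real N"
proof -
  have "expected_freq_size N pT pW =
     measure_pmf.expectation (map_pmf snd (bernoulli_model N pT pW))
       (\<lambda>I. real (card {t. t < N \<and> I t}))"
    by (simp add: expected_freq_size_def freq_set_def)
  then show ?thesis
    using assms by (simp add: bernoulli_model_def map_snd_pair_pmf expectation_card_Pi_bernoulli)
qed

end

theory Submission
  imports Defs "HOL-Real_Asymp.Real_Asymp"
begin

text \<open>
  Let \<open>F\<close> be the unitary Fourier matrix and let \<open>T\<close> and \<open>W\<close> be the random sets of times and of
  frequencies. Write \<open>R\<^sub>S\<close> for the coordinate restriction to \<open>S\<close>, and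
  let \<open>q = |W| / N\<close>. If \<open>f\<close> lives on \<open>T\<close>, the energy of its transform on \<open>W\<close> is
  \<open>q \<parallel>f\<parallel>\<^sup>2 + \<langle>f, H f\<rangle>\<close>, where \<open>H = F\<^sup>* (1\<^sub>W - q) F\<close> is hermitian, has norm at most 1 and has
  zero diagonal, because all entries of \<open>F\<close> have the same modulus. In the range of the theorem
  \<open>q\<close> tends to 0, so claim (i) follows from \<open>\<parallel>R\<^sub>T H R\<^sub>T\<parallel> \<le> 1/4\<close>. Claim (ii) is the same bound for the
  adjoint, and (iii) is immediate.

  The norm of the random compression \<open>Z\<^sub>T = R\<^sub>T H R\<^sub>T\<close> is controlled through the expected squared
  Frobenius norm \<open>M\<^sub>n\<close> of \<open>Z\<^sub>T\<^sup>n\<close>, with \<open>n\<close> of the order \<open>log N\<close>, where only those \<open>T\<close> count for which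
  all columns of \<open>Z\<^sub>T\<close> have squared norm at most \<open>R\<close>. A walk that starts in \<open>t \<in> T\<close> is cut at its last visit to \<open>t\<close>; the pieces are excursions
  \<open>\<langle>Z\<^sub>S\<^sup>j h, h\<rangle>\<close> through \<open>S = T - {t}\<close>, where \<open>h\<close> is column \<open>t\<close> of \<open>H\<close> restricted to \<open>S\<close>.
  The norms \<open>x\<^sub>j = \<parallel>Z\<^sub>S\<^sup>j h\<parallel>\<close> form a log-convex sequence, hence \<open>x\<^sub>i x\<^sub>j \<le> x\<^sub>0 x\<^bsub>i+j\<^esub>\<close>, and each
  excursion costs only a factor \<open>x\<^sub>0\<^sup>2 \<le> R\<close>. As \<open>t\<close> is independent of \<open>S\<close> and
  \<open>H\<close> is a contraction, summing \<open>x\<^sub>j\<^sup>2\<close> over \<open>t\<close> gives at most the Frobenius norm of \<open>Z\<^sub>S\<^sup>j\<close>. With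
  \<open>p \<le> 1/2\<close> for the probability that a given point belongs to \<open>T\<close>, this closes a recursion:
  \<open>M\<^sub>n \<le> N B\<^sup>2\<^sup>n\<close> as long as \<open>2 p (1 + R/B\<^sup>2)\<^sup>2\<^sup>n \<le> B\<^sup>2\<close>
  (\<open>power_frobenius_moment\<close>, resting on \<open>last_visit_decomposition\<close>, \<open>weighted_return_bound\<close> and
  \<open>sum_column_pow_le\<close>). Markov's inequality then gives \<open>compression_tail\<close>.

  Put \<open>\<ell> = (\<beta> + 1) log N\<close>. Hoeffding's inequality, applied first to \<open>W\<close> and then to \<open>T\<close>, shows
  that \<open>R = 1 / \<ell>\<close> is admissible outside an event of probability \<open>O(N\<^bsup>-\<beta>\<^esup>)\<close>. With
  \<open>2 n\<close> close to \<open>\<ell>\<close> the factor \<open>(1 + R/B\<^sup>2)\<^sup>2\<^sup>n\<close> stays bounded whereas \<open>p \<le> 0.4 / sqrt \<ell>\<close> tends to 0,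
  so the recursion applies for large \<open>N\<close> with \<open>B = 1/(4e)\<close>, and the failure probability is at most
  \<open>N (4 B)\<^sup>2\<^sup>n \<le> N\<^bsup>-\<beta>\<^esup>\<close>. The finitely many remaining \<open>N\<close> are absorbed into the constant. Since
  \<open>0.7614/2\<close> and \<open>0.2660\<close> are both below \<open>0.4\<close>, the one bound proves both assertions, with
  \<open>\<epsilon> = 0\<close>.

  Apart from orthogonality only the equal moduli of the entries of \<open>F\<close> matter, so everything up to
  the last two sections is carried out for an arbitrary unitary matrix with flat entries.
\<close>

section \<open>Vectors and compressed matrices\<close>

definition vnorm :: "'a set \<Rightarrow> ('a \<Rightarrow> complex) \<Rightarrow> real" where
  "vnorm V v = L2_set (\<lambda>i. cmod (v i)) V"

definition hinner :: "'a set \<Rightarrow> ('a \<Rightarrow> complex) \<Rightarrow> ('a \<Rightarrow> complex) \<Rightarrow> complex" where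
  "hinner V u v = (\<Sum>i\<in>V. u i * cnj (v i))"

text \<open>
  The matrix \<open>R\<^sub>S H R\<^sub>S\<close> acting on vectors. As the result vanishes
  outside \<open>S\<close>, iterates of this map sum over walks inside \<open>S\<close>.
\<close>
definition compress :: "('a \<Rightarrow> 'a \<Rightarrow> complex) \<Rightarrow> 'a set \<Rightarrow> ('a \<Rightarrow> complex) \<Rightarrow> 'a \<Rightarrow> complex" where
  "compress H S v = (\<lambda>i. if i \<in> S then \<Sum>j\<in>S. H i j * v j else 0)"

definition unit_vec :: "'a \<Rightarrow> 'a \<Rightarrow> complex" where
  "unit_vec t = (\<lambda>i. of_bool (i = t))"

lemma vnorm_nonneg [simp]: "0 \<le> vnorm V v"
  by (simp add: vnorm_def)

lemma vnorm_sq: "(vnorm V v)\<^sup>2 = (\<Sum>i\<in>V. (cmod (v i))\<^sup>2)"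
  by (simp add: vnorm_def L2_set_def sum_nonneg)

lemma vnorm_zero [simp]: "vnorm V (\<lambda>i. 0) = 0"
  by (simp add: vnorm_def L2_set_0')

lemma vnorm_add_le: "vnorm V (\<lambda>i. u i + v i) \<le> vnorm V u + vnorm V v"
proof -
  have "vnorm V (\<lambda>i. u i + v i) \<le> L2_set (\<lambda>i. cmod (u i) + cmod (v i)) V"
    unfolding vnorm_def by (intro L2_set_mono norm_triangle_ineq) simp
  also have "\<dots> \<le> vnorm V u + vnorm V v"
    unfolding vnorm_def by (rule L2_set_triangle_ineq)
  finally show ?thesis .
qed

lemma vnorm_scale: "vnorm V (\<lambda>i. a * v i) = cmod a * vnorm V v"
  by (simp add: vnorm_def norm_mult L2_set_right_distrib)

lemma vnorm_sum_le:
  "finite I \<Longrightarrow> vnorm V (\<lambda>i. \<Sum>l\<in>I. u l i) \<le> (\<Sum>l\<in>I. vnorm V (u l))"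
proof (induction I rule: finite_induct)
  case (insert l I)
  then show ?case using vnorm_add_le[of V "u l" "\<lambda>i. \<Sum>l\<in>I. u l i"] by simp
qed simp

lemma hinner_self: "hinner V v v = of_real ((vnorm V v)\<^sup>2)"
  by (simp add: hinner_def vnorm_sq complex_norm_square del: of_real_power)

lemma hinner_cauchy_schwarz: "cmod (hinner V u v) \<le> vnorm V u * vnorm V v"
proof -
  have "cmod (hinner V u v) \<le> (\<Sum>i\<in>V. \<bar>cmod (u i)\<bar> * \<bar>cmod (v i)\<bar>)"
    unfolding hinner_def by (rule order_trans[OF norm_sum]) (simp add: norm_mult)
  also have "\<dots> \<le> vnorm V u * vnorm V v"
    unfolding vnorm_def by (rule L2_set_mult_ineq)
  finally show ?thesis .
qed

lemma hinner_unit_vec: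
  assumes "finite V" "t \<in> V"
  shows "hinner V v (unit_vec t) = v t"
  using assms by (simp add: hinner_def unit_vec_def of_bool_def if_distrib[of cnj] if_distrib cong: if_cong)

lemma compress_linear:
  "compress H S (\<lambda>i. \<Sum>l\<in>I. a l * u l i) = (\<lambda>i. \<Sum>l\<in>I. a l * compress H S (u l) i)"
proof
  fix i
  have "(\<Sum>j\<in>S. H i j * (\<Sum>l\<in>I. a l * u l j)) = (\<Sum>l\<in>I. a l * (\<Sum>j\<in>S. H i j * u l j))"
    unfolding sum_distrib_left by (subst sum.swap) (simp add: mult_ac)
  then show "compress H S (\<lambda>i. \<Sum>l\<in>I. a l * u l i) i = (\<Sum>l\<in>I. a l * compress H S (u l) i)"
    by (simp add: compress_def)
qed

lemma compress_inside: "i \<in> S \<Longrightarrow> compress H S v i = (\<Sum>j\<in>S. H i j * v j)"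
  by (simp add: compress_def)

lemma compress_outside: "i \<notin> S \<Longrightarrow> compress H S v i = 0"
  by (simp add: compress_def)

lemma compress_pow_outside:
  "(\<And>i. i \<notin> S \<Longrightarrow> v i = 0) \<Longrightarrow> i \<notin> S \<Longrightarrow> (compress H S ^^ n) v i = 0"
  by (cases n) (simp_all add: compress_outside)

section \<open>Log-convex sequences\<close>

text \<open>
  The quotients \<open>x\<^bsub>k+1\<^esub> / x\<^sub>k\<close> of a log-convex sequence increase,
  so among products of two terms with a given sum of indices the one with the most distant indices
  is the largest.
\<close>
lemma log_convex_products:
  fixes x :: "nat \<Rightarrow> real"
  assumes nonneg: "\<And>k. 0 \<le> x k" and convex: "\<And>k. (x (Suc k))\<^sup>2 \<le> x k * x (Suc (Suc k))"
  shows "x i * x j \<le> x 0 * x (i + j)"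
proof -
  \<comment> \<open>The quotients increase, in a form that allows zeros.\<close>
  have ratio: "x (Suc i) * x j \<le> x i * x (Suc j)" if "i \<le> j" for i j
    using that
  proof (induction j rule: dec_induct)
    case base
    then show ?case by (simp add: mult.commute)
  next
    case (step j)
    show ?case
    proof (cases "x j = 0")
      case True
      then have "x (Suc j) = 0" using convex[of j] by simp
      then show ?thesis using nonneg by simp
    next
      case False
      then have pos: "0 < x j" using nonneg[of j] by simp
      have "x (Suc i) * x (Suc j) * x j \<le> x i * (x (Suc j))\<^sup>2"
        using mult_right_mono[OF step.IH nonneg[of "Suc j"]] by (simp add: power2_eq_square mult_ac)
      also have "\<dots> \<le> x i * x (Suc (Suc j)) * x j"
        using mult_left_mono[OF convex[of j] nonneg[of i]] by (simp add: mult_ac)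
      finally show ?thesis using pos by simp
    qed
  qed
  have le: "x i * x j \<le> x 0 * x (i + j)" if "i \<le> j" for i j
    using that
  proof (induction i arbitrary: j)
    case (Suc i)
    have "x (Suc i) * x j \<le> x i * x (Suc j)" using Suc.prems by (intro ratio) simp
    also have "\<dots> \<le> x 0 * x (i + Suc j)" using Suc.prems by (intro Suc.IH) simp
    finally show ?case by simp
  qed simp
  show ?thesis
    using le[of i j] le[of j i] by (cases "i \<le> j") (simp_all add: mult.commute add.commute)
qed

text \<open>
  The quotients increase, hence a lower bound for the first one holds for all of them.
\<close>
lemma log_convex_growth:
  fixes x :: "nat \<Rightarrow> real"
  assumes nonneg: "\<And>k. 0 \<le> x k" and convex: "\<And>k. (x (Suc k))\<^sup>2 \<le> x k * x (Suc (Suc k))"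
    and "0 \<le> \<rho>" "\<rho> * x 0 \<le> x 1"
  shows "\<rho> ^ n * x 0 \<le> x n"
proof -
  have step: "\<rho> * x k \<le> x (Suc k)" for k
  proof (induction k)
    case (Suc k)
    show ?case
    proof (cases "x k = 0 \<or> x (Suc k) = 0")
      case True
      then have "x (Suc k) = 0" using convex[of k] by auto
      then show ?thesis using nonneg by simp
    next
      case False
      then have pos: "0 < x k" using nonneg[of k] by (simp add: order_less_le)
      have "\<rho> * x (Suc k) * x k \<le> x (Suc k) * x (Suc k)"
        using mult_right_mono[OF Suc.IH nonneg[of "Suc k"]] by (simp add: mult_ac)
      also have "\<dots> \<le> x (Suc (Suc k)) * x k"
        using convex[of k] by (simp add: power2_eq_square mult_ac)
      finally show ?thesis using pos by simp
    qed
  qed (use assms in simp)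
  show ?thesis
  proof (induction n)
    case (Suc n)
    have "\<rho> ^ Suc n * x 0 \<le> \<rho> * x n"
      using mult_left_mono[OF Suc.IH \<open>0 \<le> \<rho>\<close>] by (simp add: mult_ac)
    then show ?case using step[of n] by linarith
  qed simp
qed

section \<open>Compressions of a hermitian matrix\<close>

locale hermitian_form =
  fixes V :: "'a set" and H :: "'a \<Rightarrow> 'a \<Rightarrow> complex"
  assumes finite_V: "finite V"
    and hermitian: "\<And>i j. H j i = cnj (H i j)"
begin

lemma compress_self_adjoint:
  assumes "S \<subseteq> V"
  shows "hinner V (compress H S u) v = hinner V u (compress H S v)"
proof -
  have restrict: "(\<Sum>i\<in>V. if i \<in> S then f i else 0) = (\<Sum>i\<in>S. f i)" for f :: "'a \<Rightarrow> complex"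
    using sum.mono_neutral_cong_right[OF finite_V assms, of "\<lambda>i. if i \<in> S then f i else 0" f]
    by simp
  have "hinner V (compress H S u) v = (\<Sum>i\<in>V. if i \<in> S then (\<Sum>j\<in>S. H i j * u j) * cnj (v i) else 0)"
    unfolding hinner_def compress_def by (intro sum.cong) auto
  also have "\<dots> = (\<Sum>i\<in>S. \<Sum>j\<in>S. u j * cnj (H j i * v i))"
    unfolding restrict sum_distrib_right
  proof (intro sum.cong refl)
    show "H i j * u j * cnj (v i) = u j * cnj (H j i * v i)" for i j
      unfolding hermitian[of j i] by (simp add: mult_ac)
  qed
  also have "\<dots> = (\<Sum>j\<in>S. u j * cnj (\<Sum>i\<in>S. H j i * v i))"
    by (subst sum.swap) (simp add: sum_distrib_left)
  also have "\<dots> = (\<Sum>j\<in>V. if j \<in> S then u j * cnj (\<Sum>i\<in>S. H j i * v i) else 0)"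
    by (rule restrict[symmetric])
  also have "\<dots> = hinner V u (compress H S v)"
    unfolding hinner_def compress_def by (intro sum.cong) auto
  finally show ?thesis .
qed

lemma compress_pow_self_adjoint:
  assumes "S \<subseteq> V"
  shows "hinner V ((compress H S ^^ n) u) v = hinner V u ((compress H S ^^ n) v)"
proof (induction n arbitrary: v)
  case (Suc n)
  have "hinner V ((compress H S ^^ Suc n) u) v = hinner V u ((compress H S ^^ n) (compress H S v))"
    by (simp add: compress_self_adjoint[OF assms] Suc)
  then show ?case by (simp add: funpow_swap1)
qed simp

text \<open>
  Let \<open>Z\<close> be the compression. Moving one factor across the inner product turns
  \<open>\<parallel>Z\<^sup>k\<^sup>+\<^sup>1 v\<parallel>\<^sup>2\<close> into
  \<open>\<langle>Z\<^sup>k v, Z\<^sup>k\<^sup>+\<^sup>2 v\<rangle>\<close>. This convexity does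
  the work for which one would otherwise diagonalize the matrix.
\<close>
lemma compress_pow_log_convex:
  assumes "S \<subseteq> V"
  shows "(vnorm V ((compress H S ^^ Suc k) v))\<^sup>2
    \<le> vnorm V ((compress H S ^^ k) v) * vnorm V ((compress H S ^^ Suc (Suc k)) v)"
proof -
  have "(vnorm V ((compress H S ^^ Suc k) v))\<^sup>2 = cmod (hinner V ((compress H S ^^ Suc k) v) ((compress H S ^^ Suc k) v))"
    unfolding hinner_self by (simp only: norm_of_real) simp
  also have "\<dots> = cmod (hinner V ((compress H S ^^ k) v) ((compress H S ^^ Suc (Suc k)) v))"
    by (simp add: compress_self_adjoint[OF assms])
  also have "\<dots> \<le> vnorm V ((compress H S ^^ k) v) * vnorm V ((compress H S ^^ Suc (Suc k)) v)"
    by (rule hinner_cauchy_schwarz)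
  finally show ?thesis .
qed

end

section \<open>Walks cut at their last visit\<close>

definition column_on :: "('a \<Rightarrow> 'a \<Rightarrow> complex) \<Rightarrow> 'a set \<Rightarrow> 'a \<Rightarrow> 'a \<Rightarrow> complex" where
  "column_on H S t = (\<lambda>i. if i \<in> S then H i t else 0)"

text \<open>
  The total weight of the closed walks of length \<open>k\<close> from \<open>t\<close> inside
  \<open>S \<union> {t}\<close>.
\<close>
definition return_amplitude :: "('a \<Rightarrow> 'a \<Rightarrow> complex) \<Rightarrow> 'a set \<Rightarrow> 'a \<Rightarrow> nat \<Rightarrow> complex" where
  "return_amplitude H S t k = (compress H (insert t S) ^^ k) (unit_vec t) t"

lemma return_amplitude_0 [simp]: "return_amplitude H S t 0 = 1"
  by (simp add: return_amplitude_def unit_vec_def)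

lemma column_pow_outside: "i \<notin> S \<Longrightarrow> (compress H S ^^ n) (column_on H S t) i = 0"
  by (rule compress_pow_outside) (simp_all add: column_on_def)

text \<open>
  A walk from \<open>t\<close> that does not end in \<open>t\<close> has a last visit to
  \<open>t\<close>, at some time \<open>l < k\<close>. It then steps into \<open>S\<close>, which
  contributes a column of \<open>H\<close>, and stays there for the remaining
  \<open>k - l - 1\<close> steps.
\<close>
lemma last_visit_decomposition:
  assumes "finite S" "t \<notin> S"
  shows "(compress H (insert t S) ^^ k) (unit_vec t) =
    (\<lambda>i. return_amplitude H S t k * unit_vec t i +
      (\<Sum>l<k. return_amplitude H S t l * (compress H S ^^ (k - Suc l)) (column_on H S t) i))"
    (is "?w k = (\<lambda>i. ?a k * unit_vec t i + ?u k i)")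
proof (induction k)
  case (Suc k)
  show ?case
  proof
    fix i
    have step: "?w (Suc k) i = compress H (insert t S) (\<lambda>i. ?a k * unit_vec t i + ?u k i) i"
      by (simp add: Suc.IH)
    consider "i = t" | "i \<in> S" "i \<noteq> t" | "i \<notin> insert t S" by blast
    then show "?w (Suc k) i = ?a (Suc k) * unit_vec t i + ?u (Suc k) i"
    proof cases
      case 1
      then show ?thesis
        using \<open>t \<notin> S\<close> by (simp add: return_amplitude_def unit_vec_def column_pow_outside)
    next
      case 2
      have "?u k t = 0" using \<open>t \<notin> S\<close> by (simp add: column_pow_outside)
      have "?w (Suc k) i = (\<Sum>j\<in>insert t S. H i j * (?a k * unit_vec t j + ?u k j))"
        unfolding step using 2 by (intro compress_inside) simp
      also have "\<dots> = H i t * (?a k * unit_vec t t + ?u k t) +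
          (\<Sum>j\<in>S. H i j * (?a k * unit_vec t j + ?u k j))"
        using assms by (rule sum.insert)
      also have "?a k * unit_vec t t + ?u k t = ?a k"
        unfolding \<open>?u k t = 0\<close> by (simp add: unit_vec_def)
      also have "(\<Sum>j\<in>S. H i j * (?a k * unit_vec t j + ?u k j)) = (\<Sum>j\<in>S. H i j * ?u k j)"
        using \<open>t \<notin> S\<close> by (intro sum.cong) (auto simp: unit_vec_def)
      also have "(\<Sum>j\<in>S. H i j * ?u k j) = compress H S (?u k) i"
        using 2 by (simp add: compress_def)
      also have "\<dots> = (\<Sum>l<k. ?a l * (compress H S ^^ (k - l)) (column_on H S t) i)"
      proof -
        have "compress H S ((compress H S ^^ (k - Suc l)) (column_on H S t)) =
            (compress H S ^^ (k - l)) (column_on H S t)" if "l < k" for l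
          using Suc_diff_Suc[OF that] by (metis comp_apply funpow.simps(2))
        then show ?thesis unfolding compress_linear by (intro sum.cong) simp_all
      qed
      also have "H i t * ?a k = ?a k * column_on H S t i"
        using 2 by (simp add: column_on_def)
      finally show ?thesis using 2 by (simp add: unit_vec_def)
    next
      case 3
      then show ?thesis by (simp add: compress_outside unit_vec_def column_pow_outside)
    qed
  qed
qed (simp add: unit_vec_def)

context hermitian_form
begin

text \<open>
  A closed walk of positive length must reach \<open>t\<close> from \<open>S\<close>, because the
  diagonal entry of \<open>H\<close> at \<open>t\<close> is zero. So every return is paid for by an
  excursion that begins and ends with the column at \<open>t\<close>.
\<close>
lemma return_amplitude_Suc:
  assumes "S \<subseteq> V" "t \<notin> S" "H t t = 0"
  shows "return_amplitude H S t (Suc k) = (\<Sum>l<k. return_amplitude H S t l *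
    hinner V ((compress H S ^^ (k - Suc l)) (column_on H S t)) (column_on H S t))"
    (is "_ = (\<Sum>l<k. ?a l * hinner V (?y l) ?h)")
proof -
  have "finite S" using assms finite_V finite_subset by blast
  have inner_column: "(\<Sum>j\<in>S. v j * H t j) = hinner V v ?h" for v
    unfolding hinner_def
  proof (rule sum.mono_neutral_cong_left[OF finite_V \<open>S \<subseteq> V\<close>])
    show "v j * H t j = v j * cnj (?h j)" if "j \<in> S" for j
      using that hermitian[of t j] by (simp add: column_on_def)
  qed (simp add: column_on_def)
  have "return_amplitude H S t (Suc k) =
      (\<Sum>j\<in>insert t S. H t j * (?a k * unit_vec t j + (\<Sum>l<k. ?a l * ?y l j)))"
    by (simp add: return_amplitude_def[of _ _ _ "Suc k"]
        last_visit_decomposition[OF \<open>finite S\<close> \<open>t \<notin> S\<close>] compress_def)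
  also have "\<dots> = (\<Sum>j\<in>S. H t j * (\<Sum>l<k. ?a l * ?y l j))"
    using assms \<open>finite S\<close> by (auto simp: unit_vec_def intro!: sum.cong)
  also have "\<dots> = (\<Sum>l<k. ?a l * (\<Sum>j\<in>S. ?y l j * H t j))"
    unfolding sum_distrib_left by (subst sum.swap) (simp add: mult_ac)
  also have "\<dots> = (\<Sum>l<k. ?a l * hinner V (?y l) ?h)"
    by (simp only: inner_column)
  finally show ?thesis .
qed

lemma return_amplitude_Suc_le:
  assumes "S \<subseteq> V" "t \<notin> S" "H t t = 0"
  shows "cmod (return_amplitude H S t (Suc k)) \<le> vnorm V (column_on H S t) *
    (\<Sum>l<k. cmod (return_amplitude H S t l) * vnorm V ((compress H S ^^ (k - Suc l)) (column_on H S t)))"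
  unfolding return_amplitude_Suc[OF assms] sum_distrib_left
proof (rule sum_norm_le)
  fix l
  let ?y = "(compress H S ^^ (k - Suc l)) (column_on H S t)" and ?h = "column_on H S t"
  have "cmod (return_amplitude H S t l * hinner V ?y ?h)
      \<le> cmod (return_amplitude H S t l) * (vnorm V ?y * vnorm V ?h)"
    unfolding norm_mult by (intro mult_left_mono hinner_cauchy_schwarz) simp
  then show "cmod (return_amplitude H S t l * hinner V ?y ?h)
      \<le> vnorm V ?h * (cmod (return_amplitude H S t l) * vnorm V ?y)"
    by (simp only: mult_ac)
qed

lemma walk_norm_le:
  assumes "S \<subseteq> V" "t \<in> V" "t \<notin> S"
  shows "(vnorm V ((compress H (insert t S) ^^ k) (unit_vec t)))\<^sup>2
    \<le> (cmod (return_amplitude H S t k))\<^sup>2 + (\<Sum>l<k. cmod (return_amplitude H S t l) *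
        vnorm V ((compress H S ^^ (k - Suc l)) (column_on H S t)))\<^sup>2"
    (is "(vnorm V ?w)\<^sup>2 \<le> (cmod ?a)\<^sup>2 + ?U\<^sup>2")
proof -
  have "finite S" using assms finite_V finite_subset by blast
  let ?u = "\<lambda>i. \<Sum>l<k. return_amplitude H S t l * (compress H S ^^ (k - Suc l)) (column_on H S t) i"
  have w: "?w i = ?a * unit_vec t i + ?u i" for i
    by (rule fun_cong[OF last_visit_decomposition[OF \<open>finite S\<close> \<open>t \<notin> S\<close>]])
  have "?u t = 0" using assms by (simp add: column_pow_outside)
  have "(vnorm V ?w)\<^sup>2 = (cmod (?w t))\<^sup>2 + (\<Sum>i\<in>V - {t}. (cmod (?w i))\<^sup>2)"
    unfolding vnorm_sq using finite_V \<open>t \<in> V\<close> by (rule sum.remove)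
  also have "?w t = ?a" unfolding w using \<open>?u t = 0\<close> by (simp add: unit_vec_def)
  finally have split: "(vnorm V ?w)\<^sup>2 = (cmod ?a)\<^sup>2 + (\<Sum>i\<in>V - {t}. (cmod (?w i))\<^sup>2)" .
  have "(\<Sum>i\<in>V - {t}. (cmod (?w i))\<^sup>2) = (\<Sum>i\<in>V - {t}. (cmod (?u i))\<^sup>2)"
    unfolding w by (intro sum.cong) (auto simp: unit_vec_def)
  also have "\<dots> \<le> (vnorm V ?u)\<^sup>2"
    unfolding vnorm_sq using finite_V by (intro sum_mono2) auto
  also have "\<dots> \<le> ?U\<^sup>2"
  proof (rule power_mono[OF _ vnorm_nonneg])
    have "vnorm V ?u \<le> (\<Sum>l<k. vnorm V (\<lambda>i. return_amplitude H S t l *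
        (compress H S ^^ (k - Suc l)) (column_on H S t) i))"
      by (rule vnorm_sum_le) simp
    then show "vnorm V ?u \<le> ?U" by (simp only: vnorm_scale)
  qed
  finally show ?thesis unfolding split by (rule add_left_mono)
qed

text \<open>
  By self-adjointness, entry \<open>i\<close> of \<open>Z\<^sup>m h\<^sub>t\<close> is the
  conjugate of entry \<open>t\<close> of \<open>H Z\<^sup>m e\<^sub>i\<close>. Summed over all
  \<open>t\<close> in \<open>V\<close>, the squares therefore form the squared norm of
  \<open>H\<close> applied to a vector, and \<open>H\<close> does not increase norms.
\<close>
lemma sum_column_pow_le:
  assumes contraction: "\<And>v. vnorm V (\<lambda>i. \<Sum>j\<in>V. H i j * v j) \<le> vnorm V v" and "S \<subseteq> V"
  shows "(\<Sum>t\<in>V. (vnorm V ((compress H S ^^ m) (column_on H S t)))\<^sup>2)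
    \<le> (\<Sum>i\<in>S. (vnorm V ((compress H S ^^ m) (unit_vec i)))\<^sup>2)"
proof -
  let ?w = "\<lambda>i. (compress H S ^^ m) (unit_vec i)"
  have entry: "(compress H S ^^ m) (column_on H S t) i = cnj (\<Sum>j\<in>V. H t j * ?w i j)"
    if "i \<in> S" for i t
  proof -
    have "(compress H S ^^ m) (column_on H S t) i = hinner V (column_on H S t) (?w i)"
      unfolding compress_pow_self_adjoint[OF \<open>S \<subseteq> V\<close>, symmetric]
      using that \<open>S \<subseteq> V\<close> by (intro hinner_unit_vec[symmetric] finite_V) auto
    also have "\<dots> = (\<Sum>j\<in>V. H j t * cnj (?w i j))"
    proof -
      have "?w i j = 0" if "j \<notin> S" for j
        using that \<open>i \<in> S\<close> by (intro compress_pow_outside) (auto simp: unit_vec_def)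
      then show ?thesis unfolding hinner_def column_on_def by (intro sum.cong) auto
    qed
    also have "\<dots> = cnj (\<Sum>j\<in>V. H t j * ?w i j)"
      unfolding cnj_sum complex_cnj_mult hermitian[of _ t, symmetric] ..
    finally show ?thesis .
  qed
  have "(\<Sum>t\<in>V. (vnorm V ((compress H S ^^ m) (column_on H S t)))\<^sup>2) =
      (\<Sum>t\<in>V. \<Sum>i\<in>S. (cmod ((compress H S ^^ m) (column_on H S t) i))\<^sup>2)"
    unfolding vnorm_sq using finite_V \<open>S \<subseteq> V\<close>
    by (intro sum.cong refl sum.mono_neutral_right) (auto simp: column_pow_outside)
  also have "\<dots> = (\<Sum>t\<in>V. \<Sum>i\<in>S. (cmod (\<Sum>j\<in>V. H t j * ?w i j))\<^sup>2)"
    by (intro sum.cong refl) (simp only: entry complex_mod_cnj)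
  also have "\<dots> = (\<Sum>i\<in>S. (vnorm V (\<lambda>t. \<Sum>j\<in>V. H t j * ?w i j))\<^sup>2)"
    unfolding vnorm_sq by (rule sum.swap)
  also have "\<dots> \<le> (\<Sum>i\<in>S. (vnorm V (?w i))\<^sup>2)"
    by (intro sum_mono power_mono contraction) simp
  finally show ?thesis .
qed

end

section \<open>Mean-square bounds for walks\<close>

text \<open>
  The recursion for walks, reduced to numbers: \<open>a k\<close> stands for the return amplitudes,
  \<open>x j\<close> for the norms of excursions, and \<open>w\<close> weights the pairs of a set
  and a point outside it. In the weighted \<open>L\<^sup>2\<close> norm, Minkowski's inequality
  turns the recursion into one for the numbers \<open>bet k\<close>: a return takes two steps,
  which are worth \<open>B\<^sup>2\<close>, and costs a factor \<open>R\<close>. Hence only powers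
  of \<open>\<rho> = R / B\<^sup>2\<close> appear, and \<open>(1 + \<rho>)\<^sup>m\<close>
  stays bounded when \<open>R\<close> is of order \<open>1 / m\<close>.
\<close>
lemma weighted_return_bound:
  fixes a x :: "nat \<Rightarrow> 'b \<Rightarrow> real" and w :: "'b \<Rightarrow> real"
  assumes nonneg: "\<And>k s. 0 \<le> a k s" "\<And>k s. 0 \<le> x k s" "\<And>s. 0 \<le> w s"
    and "0 < B" "0 \<le> R" "0 \<le> \<kappa>"
    and a_0: "\<And>s. a 0 s = 1"
    and a_Suc: "\<And>k s. s \<in> A \<Longrightarrow> a (Suc k) s \<le> x 0 s * (\<Sum>l<k. a l s * x (k - Suc l) s)"
    and x_mult: "\<And>i j s. s \<in> A \<Longrightarrow> x i s * x j s \<le> x 0 s * x (i + j) s"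
    and x_0: "\<And>s. s \<in> A \<Longrightarrow> (x 0 s)\<^sup>2 \<le> R"
    and x_norm: "\<And>j. j \<le> m \<Longrightarrow> (\<Sum>s\<in>A. w s * (x j s)\<^sup>2) \<le> (\<kappa> * B ^ j)\<^sup>2"
  shows "(\<Sum>s\<in>A. w s * ((a (Suc m) s)\<^sup>2 + (\<Sum>l<Suc m. a l s * x (m - l) s)\<^sup>2))
    \<le> \<kappa>\<^sup>2 * B ^ (2 * m) * (1 + R / B\<^sup>2) ^ (2 * m + 1)"
proof -
  define nrm where "nrm f = L2_set (\<lambda>s. sqrt (w s) * f s) A" for f
  have nrm_sq: "(nrm f)\<^sup>2 = (\<Sum>s\<in>A. w s * (f s)\<^sup>2)" for f
    by (simp add: nrm_def L2_set_def sum_nonneg nonneg power_mult_distrib)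
  have nrm_nonneg: "0 \<le> nrm f" for f by (simp add: nrm_def)
  have nrm_mono: "nrm f \<le> nrm g" if "\<And>s. s \<in> A \<Longrightarrow> 0 \<le> f s" "\<And>s. s \<in> A \<Longrightarrow> f s \<le> g s" for f g
    unfolding nrm_def using that nonneg by (intro L2_set_mono mult_left_mono mult_nonneg_nonneg) auto
  have nrm_add: "nrm (\<lambda>s. f s + g s) \<le> nrm f + nrm g" for f g
    unfolding nrm_def using L2_set_triangle_ineq[of "\<lambda>s. sqrt (w s) * f s" "\<lambda>s. sqrt (w s) * g s" A]
    by (simp add: distrib_left)
  have nrm_sum: "nrm (\<lambda>s. \<Sum>l\<in>I. f l s) \<le> (\<Sum>l\<in>I. nrm (f l))" if "finite I" for I :: "nat set" and f
    using that
  proof (induction I rule: finite_induct)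
    case empty
    then show ?case by (simp add: nrm_def L2_set_0')
  next
    case (insert l I)
    then show ?case using nrm_add[of "f l" "\<lambda>s. \<Sum>l\<in>I. f l s"] by simp
  qed
  have nrm_scale: "nrm (\<lambda>s. c * f s) = c * nrm f" if "0 \<le> c" for c f
    unfolding nrm_def L2_set_right_distrib[OF that] by (simp add: mult_ac)
  define \<rho> where "\<rho> = R / B\<^sup>2"
  have "0 \<le> \<rho>" using \<open>0 \<le> R\<close> by (simp add: \<rho>_def)
  have R_eq: "R = \<rho> * B\<^sup>2" using \<open>0 < B\<close> by (simp add: \<rho>_def)
  \<comment> \<open>\<open>bet (Suc m)\<close> majorizes \<open>\<rho>\<close> times the sum of the earlier values and keeps the partial sums geometric.\<close>
  define bet where "bet k = (case k of 0 \<Rightarrow> 1 | Suc m \<Rightarrow> \<rho> * (1 + \<rho>) ^ m)" for k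
  have bet_sum: "(\<Sum>l<Suc k. bet l) = (1 + \<rho>) ^ k" for k
    by (induction k) (simp_all add: bet_def algebra_simps)
  have bet_sum_le: "(\<Sum>l<k. bet l) \<le> (1 + \<rho>) ^ k" for k
  proof (cases k)
    case (Suc k')
    then show ?thesis using bet_sum[of k'] \<open>0 \<le> \<rho>\<close> by (simp add: mult_le_cancel_right1)
  qed simp
  have x_le: "nrm (x j) \<le> \<kappa> * B ^ j" if "j \<le> m" for j
    using x_norm[OF that] \<open>0 < B\<close> \<open>0 \<le> \<kappa>\<close> unfolding nrm_sq[symmetric]
    by (intro power2_le_imp_le[of "nrm (x j)"]) simp_all
  have ax_le: "nrm (\<lambda>s. a k s * x j s) \<le> \<kappa> * B ^ (j + k) * bet k" if "j + k \<le> m" for j k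
    using that
  proof (induction k arbitrary: j rule: less_induct)
    case (less k)
    show ?case
    proof (cases k)
      case 0
      then show ?thesis using x_le less.prems by (simp add: a_0 bet_def)
    next
      case (Suc k')
      \<comment> \<open>The start of the excursion pays \<open>x 0\<close>, and merging the excursion with the factor \<open>x j\<close> pays another \<open>x 0\<close>.\<close>
      have "a k s * x j s \<le> R * (\<Sum>l<k'. a l s * x (k' - Suc l + j) s)" if "s \<in> A" for s
      proof -
        have "a k s * x j s \<le> x 0 s * (\<Sum>l<k'. a l s * (x (k' - Suc l) s * x j s))"
          using mult_right_mono[OF a_Suc[OF that, of k'] nonneg(2)[of j s]]
          by (simp add: Suc sum_distrib_left sum_distrib_right mult_ac)
        also have "\<dots> \<le> x 0 s * (\<Sum>l<k'. a l s * (x 0 s * x (k' - Suc l + j) s))"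
          by (intro mult_left_mono sum_mono x_mult that nonneg)
        also have "\<dots> = (x 0 s)\<^sup>2 * (\<Sum>l<k'. a l s * x (k' - Suc l + j) s)"
          by (simp add: sum_distrib_left power2_eq_square mult_ac)
        also have "\<dots> \<le> R * (\<Sum>l<k'. a l s * x (k' - Suc l + j) s)"
          by (intro mult_right_mono x_0 that sum_nonneg mult_nonneg_nonneg nonneg)
        finally show ?thesis .
      qed
      then have "nrm (\<lambda>s. a k s * x j s) \<le> nrm (\<lambda>s. R * (\<Sum>l<k'. a l s * x (k' - Suc l + j) s))"
        by (intro nrm_mono mult_nonneg_nonneg nonneg)
      also have "\<dots> \<le> R * (\<Sum>l<k'. nrm (\<lambda>s. a l s * x (k' - Suc l + j) s))"
        unfolding nrm_scale[OF \<open>0 \<le> R\<close>] by (intro mult_left_mono nrm_sum \<open>0 \<le> R\<close>) simp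
      also have "\<dots> \<le> R * (\<Sum>l<k'. \<kappa> * B ^ (k' - Suc l + j + l) * bet l)"
        using less.prems Suc by (intro mult_left_mono sum_mono less.IH \<open>0 \<le> R\<close>) auto
      also have "\<dots> = \<kappa> * \<rho> * (\<Sum>l<k'. B ^ (j + k) * bet l)"
        unfolding R_eq sum_distrib_left
      proof (intro sum.cong refl)
        fix l assume "l \<in> {..<k'}"
        then have "j + k = k' - Suc l + j + l + 2" using Suc by auto
        then show "\<rho> * B\<^sup>2 * (\<kappa> * B ^ (k' - Suc l + j + l) * bet l) = \<kappa> * \<rho> * (B ^ (j + k) * bet l)"
          by (simp only: power_add) (simp add: mult_ac)
      qed
      also have "\<dots> = \<kappa> * B ^ (j + k) * (\<rho> * (\<Sum>l<k'. bet l))"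
        by (simp add: sum_distrib_left mult_ac)
      also have "\<dots> \<le> \<kappa> * B ^ (j + k) * (\<rho> * (1 + \<rho>) ^ k')"
        using \<open>0 < B\<close> \<open>0 \<le> \<kappa>\<close> \<open>0 \<le> \<rho>\<close> by (intro mult_left_mono bet_sum_le) auto
      finally show ?thesis by (simp add: Suc bet_def)
    qed
  qed
  define U where "U k s = (\<Sum>l<k. a l s * x (k - Suc l) s)" for k s
  have U_nonneg: "0 \<le> U k s" for k s
    unfolding U_def by (intro sum_nonneg mult_nonneg_nonneg nonneg)
  have U_le: "nrm (U (Suc k)) \<le> \<kappa> * B ^ k * (1 + \<rho>) ^ k" if "k \<le> m" for k
  proof -
    have "nrm (U (Suc k)) \<le> (\<Sum>l<Suc k. nrm (\<lambda>s. a l s * x (Suc k - Suc l) s))"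
      unfolding U_def by (rule nrm_sum) simp
    also have "\<dots> \<le> (\<Sum>l<Suc k. \<kappa> * B ^ k * bet l)"
    proof (rule sum_mono)
      fix l assume "l \<in> {..<Suc k}"
      then show "nrm (\<lambda>s. a l s * x (Suc k - Suc l) s) \<le> \<kappa> * B ^ k * bet l"
        using ax_le[of "k - l" l] that by simp
    qed
    also have "\<dots> = \<kappa> * B ^ k * (1 + \<rho>) ^ k"
      by (simp only: bet_sum flip: sum_distrib_left)
    finally show ?thesis .
  qed
  \<comment> \<open>The return at the end pays \<open>x 0\<close>, and \<open>U m\<close> is one step shorter than \<open>U (Suc m)\<close>: together a factor \<open>\<rho>\<close>.\<close>
  have a_sq: "(\<Sum>s\<in>A. w s * (a (Suc m) s)\<^sup>2) \<le> \<rho> * (\<kappa> * B ^ m * (1 + \<rho>) ^ m)\<^sup>2"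
  proof -
    have U_le_m: "B * nrm (U m) \<le> \<kappa> * B ^ m * (1 + \<rho>) ^ m"
    proof (cases m)
      case 0
      then have "U m = (\<lambda>s. 0)" by (simp add: U_def fun_eq_iff)
      then show ?thesis using 0 \<open>0 \<le> \<kappa>\<close> by (simp add: nrm_def L2_set_0')
    next
      case (Suc m')
      have "B * nrm (U m) \<le> B * (\<kappa> * B ^ m' * (1 + \<rho>) ^ m')"
        using U_le[of m'] Suc \<open>0 < B\<close> by simp
      also have "\<dots> = \<kappa> * B ^ m * (1 + \<rho>) ^ m'" by (simp add: Suc mult_ac)
      also have "\<dots> \<le> \<kappa> * B ^ m * (1 + \<rho>) ^ m"
        using \<open>0 \<le> \<rho>\<close> \<open>0 < B\<close> \<open>0 \<le> \<kappa>\<close> Suc by (intro mult_left_mono power_increasing) auto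
      finally show ?thesis .
    qed
    have "(\<Sum>s\<in>A. w s * (a (Suc m) s)\<^sup>2) \<le> (\<Sum>s\<in>A. w s * (R * (U m s)\<^sup>2))"
    proof (intro sum_mono mult_left_mono nonneg)
      fix s assume s: "s \<in> A"
      have "(a (Suc m) s)\<^sup>2 \<le> (x 0 s * U m s)\<^sup>2"
        using a_Suc[OF s, of m] nonneg by (intro power_mono) (simp_all add: U_def)
      also have "\<dots> \<le> R * (U m s)\<^sup>2"
        unfolding power_mult_distrib by (intro mult_right_mono x_0 s) simp
      finally show "(a (Suc m) s)\<^sup>2 \<le> R * (U m s)\<^sup>2" .
    qed
    also have "\<dots> = \<rho> * (B * nrm (U m))\<^sup>2"
      by (simp add: nrm_sq R_eq power_mult_distrib sum_distrib_left mult_ac)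
    also have "\<dots> \<le> \<rho> * (\<kappa> * B ^ m * (1 + \<rho>) ^ m)\<^sup>2"
      using U_le_m \<open>0 \<le> \<rho>\<close> \<open>0 < B\<close> nrm_nonneg by (intro mult_left_mono power_mono) auto
    finally show ?thesis .
  qed
  have "(\<Sum>s\<in>A. w s * ((a (Suc m) s)\<^sup>2 + (\<Sum>l<Suc m. a l s * x (m - l) s)\<^sup>2)) =
      (\<Sum>s\<in>A. w s * (a (Suc m) s)\<^sup>2) + (nrm (U (Suc m)))\<^sup>2"
    unfolding nrm_sq U_def by (simp add: distrib_left sum.distrib)
  also have "\<dots> \<le> \<rho> * (\<kappa> * B ^ m * (1 + \<rho>) ^ m)\<^sup>2 + (\<kappa> * B ^ m * (1 + \<rho>) ^ m)\<^sup>2"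
    by (intro add_mono a_sq power_mono U_le nrm_nonneg) simp
  also have "\<dots> = \<kappa>\<^sup>2 * B ^ (2 * m) * (1 + \<rho>) ^ (2 * m + 1)"
    by (simp add: power_mult_distrib power_mult[symmetric] algebra_simps)
  finally show ?thesis by (simp add: \<rho>_def)
qed

section \<open>Frobenius norms of powers of a random compression\<close>

text \<open>
  This family is closed under taking subsets, so the restriction to it survives the removal of a
  point from the set.
\<close>
definition small_column_sets :: "'a set \<Rightarrow> ('a \<Rightarrow> 'a \<Rightarrow> complex) \<Rightarrow> real \<Rightarrow> 'a set set" where
  "small_column_sets V H R = {T. T \<subseteq> V \<and> (\<forall>t\<in>T. (\<Sum>j\<in>T. (cmod (H j t))\<^sup>2) \<le> R)}"

context hermitian_form
begin

definition power_frobenius :: "'a set \<Rightarrow> nat \<Rightarrow> real" where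
  "power_frobenius S n = (\<Sum>t\<in>S. (vnorm V ((compress H S ^^ n) (unit_vec t)))\<^sup>2)"

lemma power_frobenius_0: "S \<subseteq> V \<Longrightarrow> power_frobenius S 0 = card S"
proof -
  assume "S \<subseteq> V"
  have "(vnorm V (unit_vec t))\<^sup>2 = 1" if "t \<in> S" for t
    using that \<open>S \<subseteq> V\<close> finite_V
    by (simp add: vnorm_sq unit_vec_def of_bool_def if_distrib[of "\<lambda>x. (cmod x)\<^sup>2"] subset_iff cong: if_cong)
  then show ?thesis by (simp add: power_frobenius_def)
qed

lemma small_column_sets_downward:
  assumes "T \<in> small_column_sets V H R" "S \<subseteq> T"
  shows "S \<in> small_column_sets V H R"
proof -
  have "finite T" using assms finite_V finite_subset by (auto simp: small_column_sets_def)
  then have "(\<Sum>j\<in>S. (cmod (H j t))\<^sup>2) \<le> (\<Sum>j\<in>T. (cmod (H j t))\<^sup>2)" for t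
    using assms(2) by (intro sum_mono2) auto
  then show ?thesis
    using assms unfolding small_column_sets_def by (blast intro: order_trans)
qed

text \<open>
  A set \<open>T\<close> with a point \<open>t\<close> of \<open>T\<close> is the same as
  \<open>S = T - {t}\<close> with a point outside \<open>S\<close>; exchanging the two
  descriptions costs the factor \<open>c\<close>, for Bernoulli sets the odds of containing a given
  point. The powers of the compression to \<open>T\<close> are then expressed through lower powers
  of the compression to \<open>S\<close>, to which the induction hypothesis applies.
\<close>
lemma power_frobenius_moment:
  fixes wt :: "'a set \<Rightarrow> real" and c B R :: real
  assumes contraction: "\<And>v. vnorm V (\<lambda>i. \<Sum>j\<in>V. H i j * v j) \<le> vnorm V v"
    and hollow: "\<And>t. t \<in> V \<Longrightarrow> H t t = 0"
    and wt_nonneg: "\<And>S. 0 \<le> wt S" and wt_sum: "(\<Sum>S\<in>Pow V. wt S) \<le> 1"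
    and wt_insert: "\<And>S t. S \<subseteq> V \<Longrightarrow> t \<in> V - S \<Longrightarrow> wt (insert t S) \<le> c * wt S"
    and "0 \<le> c" "0 < B" "0 \<le> R" and small: "c * (1 + R / B\<^sup>2) ^ (2 * n) \<le> B\<^sup>2"
  shows "(\<Sum>T\<in>small_column_sets V H R. wt T * power_frobenius T n) \<le> card V * B ^ (2 * n)"
  using small
proof (induction n rule: less_induct)
  case (less n)
  let ?G = "small_column_sets V H R"
  have G_Pow: "?G \<subseteq> Pow V" by (auto simp: small_column_sets_def)
  have fin_G: "finite ?G" using G_Pow finite_V finite_subset by blast
  show ?case
  proof (cases n)
    case 0
    have "(\<Sum>T\<in>?G. wt T * power_frobenius T 0) \<le> (\<Sum>T\<in>?G. wt T * card V)"
      using G_Pow finite_V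
      by (intro sum_mono mult_left_mono wt_nonneg) (auto simp: power_frobenius_0 intro!: card_mono)
    also have "\<dots> = card V * (\<Sum>T\<in>?G. wt T)" by (simp add: sum_distrib_left mult.commute)
    also have "\<dots> \<le> card V * (\<Sum>T\<in>Pow V. wt T)"
      using G_Pow finite_V wt_nonneg by (intro mult_left_mono sum_mono2) auto
    also have "\<dots> \<le> real (card V) * 1"
      using wt_sum by (intro mult_left_mono) auto
    finally show ?thesis by (simp add: 0)
  next
    case (Suc m)
    define A where "A = {(S, t). S \<subseteq> V \<and> t \<in> V - S \<and> insert t S \<in> ?G}"
    define a where "a k s = cmod (return_amplitude H (fst s) (snd s) k)" for k and s :: "'a set \<times> 'a"
    define x where "x j s = vnorm V ((compress H (fst s) ^^ j) (column_on H (fst s) (snd s)))"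
      for j and s :: "'a set \<times> 'a"
    have A_sub: "A \<subseteq> ?G \<times> V"
      unfolding A_def using small_column_sets_downward by blast
    have prev: "(\<Sum>T\<in>?G. wt T * power_frobenius T j) \<le> card V * B ^ (2 * j)" if "j < n" for j
    proof (rule less.IH[OF that])
      have "c * (1 + R / B\<^sup>2) ^ (2 * j) \<le> c * (1 + R / B\<^sup>2) ^ (2 * n)"
        using \<open>0 \<le> c\<close> \<open>0 \<le> R\<close> that by (intro mult_left_mono power_increasing) auto
      then show "c * (1 + R / B\<^sup>2) ^ (2 * j) \<le> B\<^sup>2" using less.prems by linarith
    qed
    have x_norm: "(\<Sum>s\<in>A. wt (fst s) * (x j s)\<^sup>2) \<le> (sqrt (card V) * B ^ j)\<^sup>2" if "j \<le> m" for j
    proof -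
      have "(\<Sum>s\<in>A. wt (fst s) * (x j s)\<^sup>2) \<le> (\<Sum>s\<in>?G \<times> V. wt (fst s) * (x j s)\<^sup>2)"
        using A_sub fin_G finite_V wt_nonneg by (intro sum_mono2) auto
      also have "\<dots> = (\<Sum>S\<in>?G. wt S * (\<Sum>t\<in>V. (x j (S, t))\<^sup>2))"
        by (simp add: sum.cartesian_product sum_distrib_left split_beta)
      also have "\<dots> \<le> (\<Sum>S\<in>?G. wt S * power_frobenius S j)"
        unfolding power_frobenius_def x_def fst_conv snd_conv using G_Pow
        by (intro sum_mono mult_left_mono wt_nonneg sum_column_pow_le contraction) auto
      also have "\<dots> \<le> card V * B ^ (2 * j)"
        using that Suc by (intro prev) simp
      finally show ?thesis by (simp add: power_mult_distrib power_mult[symmetric] mult.commute)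
    qed
    have bij: "bij_betw (\<lambda>(S, t). (insert t S, t)) A (SIGMA T:?G. T)"
      by (rule bij_betw_byWitness[where f' = "\<lambda>(T, t). (T - {t}, t)"])
        (use G_Pow in \<open>auto simp: A_def insert_absorb\<close>)
    have "(\<Sum>T\<in>?G. wt T * power_frobenius T n) =
        (\<Sum>(T, t)\<in>(SIGMA T:?G. T). wt T * (vnorm V ((compress H T ^^ n) (unit_vec t)))\<^sup>2)"
      unfolding power_frobenius_def sum_distrib_left
      using fin_G G_Pow finite_V by (intro sum.Sigma) (auto intro: finite_subset)
    also have "\<dots> = (\<Sum>(S, t)\<in>A. wt (insert t S) *
        (vnorm V ((compress H (insert t S) ^^ n) (unit_vec t)))\<^sup>2)"
      unfolding sum.reindex_bij_betw[OF bij, symmetric] by (simp add: split_beta)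
    also have "\<dots> \<le> (\<Sum>s\<in>A. c * (wt (fst s) * ((a (Suc m) s)\<^sup>2 + (\<Sum>l<Suc m. a l s * x (m - l) s)\<^sup>2)))"
    proof (rule sum_mono)
      fix s assume "s \<in> A"
      then obtain S t where s: "s = (S, t)" "S \<subseteq> V" "t \<in> V" "t \<notin> S" by (auto simp: A_def)
      have "wt (insert t S) * (vnorm V ((compress H (insert t S) ^^ n) (unit_vec t)))\<^sup>2
          \<le> (c * wt S) * ((a (Suc m) s)\<^sup>2 + (\<Sum>l<Suc m. a l s * x (m - l) s)\<^sup>2)"
        using walk_norm_le[OF s(2-4), of n] wt_insert[of S t] s wt_nonneg \<open>0 \<le> c\<close>
        by (intro mult_mono) (simp_all add: a_def x_def Suc)
      then show "(case s of (S, t) \<Rightarrow> wt (insert t S) *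
          (vnorm V ((compress H (insert t S) ^^ n) (unit_vec t)))\<^sup>2)
          \<le> c * (wt (fst s) * ((a (Suc m) s)\<^sup>2 + (\<Sum>l<Suc m. a l s * x (m - l) s)\<^sup>2))"
        by (simp add: s(1) mult.assoc)
    qed
    also have "\<dots> = c * (\<Sum>s\<in>A. wt (fst s) * ((a (Suc m) s)\<^sup>2 + (\<Sum>l<Suc m. a l s * x (m - l) s)\<^sup>2))"
      by (rule sum_distrib_left[symmetric])
    also have "\<dots> \<le> c * ((sqrt (card V))\<^sup>2 * B ^ (2 * m) * (1 + R / B\<^sup>2) ^ (2 * m + 1))"
    proof (rule mult_left_mono[OF weighted_return_bound \<open>0 \<le> c\<close>])
      fix s assume "s \<in> A"
      then obtain S t where s: "s = (S, t)" "S \<subseteq> V" "t \<in> V" "t \<notin> S" and G: "insert t S \<in> ?G"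
        by (auto simp: A_def)
      show "a (Suc k) s \<le> x 0 s * (\<Sum>l<k. a l s * x (k - Suc l) s)" for k
        using return_amplitude_Suc_le[OF s(2,4) hollow[OF s(3)], of k] by (simp add: a_def x_def s(1))
      show "x i s * x j s \<le> x 0 s * x (i + j) s" for i j
        unfolding x_def s(1)
        by (rule log_convex_products) (use compress_pow_log_convex[OF s(2)] in simp_all)
      have "(x 0 s)\<^sup>2 = (\<Sum>j\<in>S. (cmod (H j t))\<^sup>2)"
        unfolding x_def s(1) funpow_0 fst_conv snd_conv vnorm_sq using s(2) finite_V
        by (intro sum.mono_neutral_cong_right) (auto simp: column_on_def)
      also have "\<dots> \<le> (\<Sum>j\<in>insert t S. (cmod (H j t))\<^sup>2)"
        using s finite_V finite_subset by (intro sum_mono2) auto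
      also have "\<dots> \<le> R" using G by (auto simp: small_column_sets_def)
      finally show "(x 0 s)\<^sup>2 \<le> R" .
    qed (use x_norm wt_nonneg \<open>0 < B\<close> \<open>0 \<le> R\<close> in \<open>simp_all add: a_def x_def\<close>)
    also have "\<dots> \<le> card V * B ^ (2 * m) * (c * (1 + R / B\<^sup>2) ^ (2 * n))"
    proof -
      have "(1 + R / B\<^sup>2) ^ (2 * m + 1) \<le> (1 + R / B\<^sup>2) ^ (2 * n)"
        using Suc \<open>0 \<le> R\<close> by (intro power_increasing) auto
      then have "card V * B ^ (2 * m) * c * (1 + R / B\<^sup>2) ^ (2 * m + 1)
          \<le> card V * B ^ (2 * m) * c * (1 + R / B\<^sup>2) ^ (2 * n)"
        using \<open>0 \<le> c\<close> \<open>0 < B\<close> by (intro mult_left_mono) auto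
      then show ?thesis by (simp add: mult_ac)
    qed
    also have "\<dots> \<le> card V * B ^ (2 * m) * B\<^sup>2"
      using less.prems \<open>0 < B\<close> by (intro mult_left_mono) auto
    also have "\<dots> = card V * B ^ (2 * n)"
      by (simp add: Suc power2_eq_square)
    finally show ?thesis .
  qed
qed

lemma compress_pow_le_frobenius:
  assumes "S \<subseteq> V" and supp: "\<And>i. i \<notin> S \<Longrightarrow> f i = 0"
  shows "(vnorm V ((compress H S ^^ n) f))\<^sup>2 \<le> power_frobenius S n * (vnorm V f)\<^sup>2"
proof -
  have entry: "(cmod ((compress H S ^^ n) f i))\<^sup>2
      \<le> (vnorm V ((compress H S ^^ n) (unit_vec i)))\<^sup>2 * (vnorm V f)\<^sup>2" if "i \<in> S" for i
  proof -
    have "(compress H S ^^ n) f i = hinner V ((compress H S ^^ n) f) (unit_vec i)"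
      using that assms finite_V by (subst hinner_unit_vec) auto
    also have "\<dots> = hinner V f ((compress H S ^^ n) (unit_vec i))"
      by (rule compress_pow_self_adjoint[OF \<open>S \<subseteq> V\<close>])
    finally have "cmod ((compress H S ^^ n) f i)
        \<le> vnorm V f * vnorm V ((compress H S ^^ n) (unit_vec i))"
      using hinner_cauchy_schwarz by metis
    then show ?thesis
      unfolding power_mult_distrib[symmetric] by (intro power_mono) (simp_all add: mult.commute)
  qed
  have "(vnorm V ((compress H S ^^ n) f))\<^sup>2 = (\<Sum>i\<in>S. (cmod ((compress H S ^^ n) f i))\<^sup>2)"
    unfolding vnorm_sq using finite_V \<open>S \<subseteq> V\<close>
    by (intro sum.mono_neutral_right) (auto simp: compress_pow_outside supp)
  also have "\<dots> \<le> power_frobenius S n * (vnorm V f)\<^sup>2"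
    unfolding power_frobenius_def sum_distrib_right by (intro sum_mono entry)
  finally show ?thesis .
qed

text \<open>
  One vector that is stretched by more than \<open>r\<close> is stretched by at least
  \<open>r\<^sup>n\<close> by the \<open>n\<close>-th power.
\<close>
lemma power_frobenius_ge:
  assumes "S \<subseteq> V" and supp: "\<And>i. i \<notin> S \<Longrightarrow> f i = 0"
    and "0 \<le> r" and large: "r * vnorm V f < vnorm V (compress H S f)"
  shows "r ^ (2 * n) \<le> power_frobenius S n"
proof -
  have "vnorm V f \<noteq> 0"
  proof
    assume "vnorm V f = 0"
    then have "vnorm V (compress H S f) = 0"
      using compress_pow_le_frobenius[of S f 1] assms by simp
    then show False using large \<open>vnorm V f = 0\<close> by simp
  qed
  then have pos: "0 < (vnorm V f)\<^sup>2" by simp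
  have "r ^ n * vnorm V f \<le> vnorm V ((compress H S ^^ n) f)"
    using log_convex_growth[of "\<lambda>k. vnorm V ((compress H S ^^ k) f)" r n]
      compress_pow_log_convex[OF \<open>S \<subseteq> V\<close>, of _ f] \<open>0 \<le> r\<close> large by simp
  then have "(r ^ n * vnorm V f)\<^sup>2 \<le> (vnorm V ((compress H S ^^ n) f))\<^sup>2"
    using \<open>0 \<le> r\<close> by (intro power_mono) auto
  also have "\<dots> \<le> power_frobenius S n * (vnorm V f)\<^sup>2"
    using assms by (intro compress_pow_le_frobenius) auto
  finally have "r ^ (2 * n) * (vnorm V f)\<^sup>2 \<le> power_frobenius S n * (vnorm V f)\<^sup>2"
    by (simp add: power_mult_distrib power_mult[symmetric] mult.commute)
  then show ?thesis using pos by simp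
qed

text \<open>
  Markov's inequality for the \<open>n\<close>-th power, restricted to the sets with small columns.
\<close>
lemma compression_tail:
  fixes wt :: "'a set \<Rightarrow> real" and c B R :: real
  assumes contraction: "\<And>v. vnorm V (\<lambda>i. \<Sum>j\<in>V. H i j * v j) \<le> vnorm V v"
    and hollow: "\<And>t. t \<in> V \<Longrightarrow> H t t = 0"
    and wt_nonneg: "\<And>S. 0 \<le> wt S" and wt_sum: "(\<Sum>S\<in>Pow V. wt S) \<le> 1"
    and wt_insert: "\<And>S t. S \<subseteq> V \<Longrightarrow> t \<in> V - S \<Longrightarrow> wt (insert t S) \<le> c * wt S"
    and "0 \<le> c" "0 < B" "0 \<le> R" and small: "c * (1 + R / B\<^sup>2) ^ (2 * n) \<le> B\<^sup>2" and "0 < r"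
  shows "(\<Sum>T | T \<in> small_column_sets V H R \<and>
      (\<exists>f. (\<forall>i. i \<notin> T \<longrightarrow> f i = 0) \<and> r * vnorm V f < vnorm V (compress H T f)). wt T)
    \<le> card V * (B / r) ^ (2 * n)" (is "(\<Sum>T | T \<in> ?G \<and> ?bad T. wt T) \<le> _")
proof -
  have fin_G: "finite ?G" using finite_V by (simp add: small_column_sets_def)
  have nonneg: "0 \<le> power_frobenius T n" for T
    unfolding power_frobenius_def by (intro sum_nonneg) simp
  have "(\<Sum>T | T \<in> ?G \<and> ?bad T. wt T) * r ^ (2 * n) = (\<Sum>T | T \<in> ?G \<and> ?bad T. wt T * r ^ (2 * n))"
    by (rule sum_distrib_right)
  also have "\<dots> \<le> (\<Sum>T | T \<in> ?G \<and> ?bad T. wt T * power_frobenius T n)"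
  proof (intro sum_mono mult_left_mono wt_nonneg)
    fix T assume "T \<in> {T. T \<in> ?G \<and> ?bad T}"
    then show "r ^ (2 * n) \<le> power_frobenius T n"
      using power_frobenius_ge[of T _ r n] \<open>0 < r\<close> by (auto simp: small_column_sets_def)
  qed
  also have "\<dots> \<le> (\<Sum>T\<in>?G. wt T * power_frobenius T n)"
    using fin_G nonneg wt_nonneg by (intro sum_mono2) auto
  also have "\<dots> \<le> card V * B ^ (2 * n)"
    by (rule power_frobenius_moment[OF assms(1-9)])
  finally show ?thesis
    using \<open>0 < r\<close> by (simp add: power_divide pos_le_divide_eq)
qed

end

section \<open>Unitary matrices with flat entries\<close>

lemma orthonormal_columns_inner:
  assumes "\<And>t t'. t \<in> V \<Longrightarrow> t' \<in> V \<Longrightarrow> (\<Sum>w\<in>V. A w t * cnj (A w t')) = of_bool (t = t')"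
    and "finite V"
  shows "hinner V (\<lambda>w. \<Sum>t\<in>V. A w t * u t) (\<lambda>w. \<Sum>t\<in>V. A w t * v t) = hinner V u v"
proof -
  have "hinner V (\<lambda>w. \<Sum>t\<in>V. A w t * u t) (\<lambda>w. \<Sum>t\<in>V. A w t * v t) =
      (\<Sum>w\<in>V. \<Sum>t\<in>V. \<Sum>t'\<in>V. (A w t * cnj (A w t')) * (u t * cnj (v t')))"
    by (simp add: hinner_def sum_product mult_ac)
  also have "\<dots> = (\<Sum>t\<in>V. \<Sum>w\<in>V. \<Sum>t'\<in>V. (A w t * cnj (A w t')) * (u t * cnj (v t')))"
    by (rule sum.swap)
  also have "\<dots> = (\<Sum>t\<in>V. \<Sum>t'\<in>V. (\<Sum>w\<in>V. A w t * cnj (A w t')) * (u t * cnj (v t')))"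
    unfolding sum_distrib_right by (intro sum.cong refl sum.swap)
  also have "\<dots> = (\<Sum>t\<in>V. \<Sum>t'\<in>V. if t = t' then u t * cnj (v t') else 0)"
    by (intro sum.cong refl) (simp add: assms(1))
  also have "\<dots> = hinner V u v"
    using \<open>finite V\<close> by (simp add: hinner_def)
  finally show ?thesis .
qed

lemma orthonormal_columns_isometry:
  assumes "\<And>t t'. t \<in> V \<Longrightarrow> t' \<in> V \<Longrightarrow> (\<Sum>w\<in>V. A w t * cnj (A w t')) = of_bool (t = t')"
    and "finite V"
  shows "vnorm V (\<lambda>w. \<Sum>t\<in>V. A w t * v t) = vnorm V v"
proof -
  have "(vnorm V (\<lambda>w. \<Sum>t\<in>V. A w t * v t))\<^sup>2 = (vnorm V v)\<^sup>2"
    using orthonormal_columns_inner[OF assms, of v v] unfolding hinner_self of_real_eq_iff .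
  then show ?thesis by (simp add: power2_eq_iff_nonneg)
qed

locale flat_unitary =
  fixes V :: "'a set" and U :: "'a \<Rightarrow> 'a \<Rightarrow> complex"
  assumes finite_V: "finite V" and V_nonempty: "V \<noteq> {}"
    and orthonormal_columns: "\<And>t t'. t \<in> V \<Longrightarrow> t' \<in> V \<Longrightarrow>
      (\<Sum>w\<in>V. U w t * cnj (U w t')) = of_bool (t = t')"
    and orthonormal_rows: "\<And>w w'. w \<in> V \<Longrightarrow> w' \<in> V \<Longrightarrow>
      (\<Sum>t\<in>V. U w t * cnj (U w' t)) = of_bool (w = w')"
    and flat: "\<And>w t. w \<in> V \<Longrightarrow> t \<in> V \<Longrightarrow> (cmod (U w t))\<^sup>2 = 1 / card V"
begin

definition transform :: "('a \<Rightarrow> complex) \<Rightarrow> 'a \<Rightarrow> complex" where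
  "transform v w = (\<Sum>t\<in>V. U w t * v t)"

definition sampling_ratio :: "'a set \<Rightarrow> real" where
  "sampling_ratio W = card W / card V"

text \<open>
  Subtracting the mean of the indicator leaves the entries off the diagonal unchanged and makes the
  diagonal vanish.
\<close>
definition centered :: "'a set \<Rightarrow> 'a \<Rightarrow> real" where
  "centered W w = indicator W w - sampling_ratio W"

text \<open>
  The matrix \<open>U\<^sup>* D U\<close>, where \<open>D\<close> is the diagonal matrix with
  entries \<open>centered W w\<close>.
\<close>
definition filter_matrix :: "'a set \<Rightarrow> 'a \<Rightarrow> 'a \<Rightarrow> complex" where
  "filter_matrix W i j = (\<Sum>w\<in>V. of_real (centered W w) * cnj (U w i) * U w j)"

lemma card_V_pos: "0 < card V"
  using finite_V V_nonempty by (simp add: card_gt_0_iff)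

lemma hermitian_filter: "hermitian_form V (filter_matrix W)"
  by unfold_locales (simp_all add: finite_V filter_matrix_def mult_ac)

lemma hinner_transform: "hinner V (transform u) (transform v) = hinner V u v"
  unfolding transform_def[abs_def]
  by (rule orthonormal_columns_inner[OF orthonormal_columns finite_V])

lemma vnorm_transform: "vnorm V (transform v) = vnorm V v"
  unfolding transform_def[abs_def]
  by (rule orthonormal_columns_isometry[OF orthonormal_columns finite_V])

lemma vnorm_adjoint: "vnorm V (\<lambda>t. \<Sum>w\<in>V. cnj (U w t) * y w) = vnorm V y"
proof (rule orthonormal_columns_isometry[OF _ finite_V])
  fix w w' assume "w \<in> V" "w' \<in> V"
  then have "(\<Sum>t\<in>V. U w' t * cnj (U w t)) = of_bool (w = w')"
    by (simp add: orthonormal_rows eq_commute)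
  then show "(\<Sum>t\<in>V. cnj (U w t) * cnj (cnj (U w' t))) = of_bool (w = w')"
    by (simp add: mult.commute)
qed

lemma filter_apply:
  "(\<Sum>j\<in>V. filter_matrix W i j * v j) =
    (\<Sum>w\<in>V. cnj (U w i) * (of_real (centered W w) * transform v w))"
  unfolding filter_matrix_def transform_def sum_distrib_left sum_distrib_right
  by (subst sum.swap) (simp add: mult_ac)

lemma vnorm_filter:
  "vnorm V (\<lambda>i. \<Sum>j\<in>V. filter_matrix W i j * v j) =
    vnorm V (\<lambda>w. of_real (centered W w) * transform v w)"
  unfolding filter_apply by (rule vnorm_adjoint)

lemma sampling_ratio_bounds: "W \<subseteq> V \<Longrightarrow> 0 \<le> sampling_ratio W \<and> sampling_ratio W \<le> 1"
  using card_mono[OF finite_V, of W] card_V_pos by (simp add: sampling_ratio_def)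

lemma filter_contraction:
  assumes "W \<subseteq> V"
  shows "vnorm V (\<lambda>i. \<Sum>j\<in>V. filter_matrix W i j * v j) \<le> vnorm V v"
proof -
  have "\<bar>centered W w\<bar> \<le> 1" for w
    using sampling_ratio_bounds[OF assms] by (simp add: centered_def indicator_def)
  then have "vnorm V (\<lambda>w. of_real (centered W w) * transform v w) \<le> vnorm V (transform v)"
    unfolding vnorm_def norm_mult norm_of_real by (intro L2_set_mono mult_left_le_one_le) auto
  then show ?thesis by (simp only: vnorm_filter vnorm_transform)
qed

lemma sum_indicator_subset: "W \<subseteq> V \<Longrightarrow> (\<Sum>w\<in>V. indicator W w) = real (card W)"
  using finite_V by (simp add: indicator_def sum.If_cases Int_absorb1)

lemma sum_centered: "W \<subseteq> V \<Longrightarrow> (\<Sum>w\<in>V. centered W w) = 0"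
  using card_V_pos V_nonempty
  by (simp add: centered_def sum_subtractf sampling_ratio_def sum_indicator_subset)

lemma filter_hollow:
  assumes "W \<subseteq> V" "t \<in> V"
  shows "filter_matrix W t t = 0"
proof -
  have "filter_matrix W t t = (\<Sum>w\<in>V. of_real (centered W w) * (1 / of_nat (card V)))"
    unfolding filter_matrix_def
  proof (intro sum.cong refl)
    fix w assume "w \<in> V"
    then have "cnj (U w t) * U w t = of_real ((cmod (U w t))\<^sup>2)"
      by (simp only: complex_norm_square mult.commute)
    then show "of_real (centered W w) * cnj (U w t) * U w t = of_real (centered W w) * (1 / of_nat (card V))"
      using flat[OF \<open>w \<in> V\<close> \<open>t \<in> V\<close>] by (simp add: mult.assoc)
  qed
  also have "\<dots> = of_real (\<Sum>w\<in>V. centered W w) * (1 / of_nat (card V))"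
    by (simp add: sum_divide_distrib)
  finally show ?thesis using sum_centered[OF \<open>W \<subseteq> V\<close>] by simp
qed

lemma filter_offdiag:
  assumes "W \<subseteq> V" "i \<in> V" "j \<in> V" "i \<noteq> j"
  shows "filter_matrix W i j = (\<Sum>w\<in>W. cnj (U w i) * U w j)"
proof -
  have "(\<Sum>w\<in>V. cnj (U w i) * U w j) = 0"
    using orthonormal_columns[OF \<open>j \<in> V\<close> \<open>i \<in> V\<close>] assms(4) by (simp add: mult.commute)
  then have "(\<Sum>w\<in>V. of_real (sampling_ratio W) * (cnj (U w i) * U w j)) = 0"
    by (simp flip: sum_distrib_left)
  moreover have "filter_matrix W i j = (\<Sum>w\<in>V. indicator W w * (cnj (U w i) * U w j)) -
      (\<Sum>w\<in>V. of_real (sampling_ratio W) * (cnj (U w i) * U w j))"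
    unfolding filter_matrix_def centered_def sum_subtractf[symmetric]
    by (intro sum.cong refl) (simp add: algebra_simps of_real_indicator)
  moreover have "(\<Sum>w\<in>V. indicator W w * (cnj (U w i) * U w j)) = (\<Sum>w\<in>W. cnj (U w i) * U w j)"
    using finite_V \<open>W \<subseteq> V\<close> by (intro sum.mono_neutral_cong_right) auto
  ultimately show ?thesis by simp
qed

text \<open>
  The squared norm of a column is the variance \<open>q (1 - q)\<close> of the indicator of
  \<open>W\<close>, where \<open>q\<close> is the sampling ratio.
\<close>
lemma filter_column_sum:
  assumes "W \<subseteq> V" "t \<in> V"
  shows "(\<Sum>j\<in>V. (cmod (filter_matrix W j t))\<^sup>2) \<le> sampling_ratio W"
proof -
  have "(\<Sum>j\<in>V. filter_matrix W i j * unit_vec t j) = filter_matrix W i t" for i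
    using finite_V \<open>t \<in> V\<close> by (simp add: unit_vec_def)
  then have "(\<Sum>j\<in>V. (cmod (filter_matrix W j t))\<^sup>2) =
      (vnorm V (\<lambda>i. \<Sum>j\<in>V. filter_matrix W i j * unit_vec t j))\<^sup>2"
    by (simp add: vnorm_sq)
  also have "\<dots> = (\<Sum>w\<in>V. (centered W w)\<^sup>2 * (1 / card V))"
    unfolding vnorm_filter vnorm_sq
  proof (intro sum.cong refl)
    fix w assume "w \<in> V"
    have "transform (unit_vec t) w = U w t"
      using finite_V \<open>t \<in> V\<close> by (simp add: transform_def unit_vec_def)
    then show "(cmod (of_real (centered W w) * transform (unit_vec t) w))\<^sup>2 = (centered W w)\<^sup>2 * (1 / card V)"
      using flat[OF \<open>w \<in> V\<close> \<open>t \<in> V\<close>] by (simp add: norm_mult power_mult_distrib)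
  qed
  also have "\<dots> = (\<Sum>w\<in>V. centered W w * centered W w) / card V"
    by (simp add: sum_divide_distrib power2_eq_square)
  also have "(\<Sum>w\<in>V. centered W w * centered W w) =
      (\<Sum>w\<in>V. indicator W w * (1 - sampling_ratio W)) - (\<Sum>w\<in>V. sampling_ratio W * centered W w)"
    unfolding sum_subtractf[symmetric]
    by (intro sum.cong refl) (auto simp: centered_def indicator_def algebra_simps)
  also have "\<dots> = card W * (1 - sampling_ratio W)"
    using sum_centered[OF \<open>W \<subseteq> V\<close>] sum_indicator_subset[OF \<open>W \<subseteq> V\<close>]
    by (simp add: sum_distrib_left[symmetric] sum_distrib_right[symmetric])
  also have "\<dots> / card V = sampling_ratio W * (1 - sampling_ratio W)" by (simp add: sampling_ratio_def)
  also have "\<dots> \<le> sampling_ratio W"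
    using sampling_ratio_bounds[OF \<open>W \<subseteq> V\<close>] by (simp add: mult_left_le)
  finally show ?thesis .
qed

text \<open>
  The energy on \<open>W\<close> is the quadratic form of \<open>U\<^sup>* 1\<^sub>W U\<close>,
  which exceeds the filter matrix by \<open>q\<close> times the identity.
\<close>
lemma concentration_from_compression:
  assumes "W \<subseteq> V" "T \<subseteq> V" and supp: "\<And>t. t \<notin> T \<Longrightarrow> f t = 0"
    and "vnorm V (compress (filter_matrix W) T f) \<le> r * vnorm V f"
  shows "(\<Sum>w\<in>W. (cmod (transform f w))\<^sup>2) \<le> (sampling_ratio W + r) * (vnorm V f)\<^sup>2"
proof -
  have "(\<Sum>w\<in>V. of_real (centered W w) * (transform f w * cnj (transform f w))) =
      (\<Sum>w\<in>V. \<Sum>i\<in>V. (cnj (U w i) * (of_real (centered W w) * transform f w)) * cnj (f i))"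
    unfolding transform_def by (simp add: sum_distrib_left mult_ac)
  also have "\<dots> = (\<Sum>i\<in>V. (\<Sum>j\<in>V. filter_matrix W i j * f j) * cnj (f i))"
    unfolding filter_apply sum_distrib_right by (rule sum.swap)
  also have "\<dots> = hinner V (compress (filter_matrix W) T f) f"
    unfolding hinner_def
  proof (intro sum.cong refl)
    fix i assume "i \<in> V"
    have "(\<Sum>j\<in>V. filter_matrix W i j * f j) = (\<Sum>j\<in>T. filter_matrix W i j * f j)"
      using finite_V \<open>T \<subseteq> V\<close> supp by (intro sum.mono_neutral_right) auto
    then show "(\<Sum>j\<in>V. filter_matrix W i j * f j) * cnj (f i) = compress (filter_matrix W) T f i * cnj (f i)"
      using supp by (cases "i \<in> T") (simp_all add: compress_def)
  qed
  finally have form: "hinner V (compress (filter_matrix W) T f) f =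
      of_real (\<Sum>w\<in>V. centered W w * (cmod (transform f w))\<^sup>2)"
    by (simp add: complex_norm_square del: of_real_power)
  have "(\<Sum>w\<in>V. centered W w * (cmod (transform f w))\<^sup>2) =
      (\<Sum>w\<in>V. indicator W w * (cmod (transform f w))\<^sup>2) - sampling_ratio W * (\<Sum>w\<in>V. (cmod (transform f w))\<^sup>2)"
    by (simp add: centered_def left_diff_distrib sum_subtractf sum_distrib_left)
  also have "(\<Sum>w\<in>V. indicator W w * (cmod (transform f w))\<^sup>2) = (\<Sum>w\<in>W. (cmod (transform f w))\<^sup>2)"
    using finite_V \<open>W \<subseteq> V\<close> by (intro sum.mono_neutral_cong_right) auto
  also have "(\<Sum>w\<in>V. (cmod (transform f w))\<^sup>2) = (vnorm V f)\<^sup>2"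
    by (simp only: vnorm_sq[symmetric] vnorm_transform)
  finally have "(\<Sum>w\<in>W. (cmod (transform f w))\<^sup>2) =
      sampling_ratio W * (vnorm V f)\<^sup>2 + (\<Sum>w\<in>V. centered W w * (cmod (transform f w))\<^sup>2)"
    by simp
  also have "(\<Sum>w\<in>V. centered W w * (cmod (transform f w))\<^sup>2) \<le> r * vnorm V f * vnorm V f"
  proof -
    have "(\<Sum>w\<in>V. centered W w * (cmod (transform f w))\<^sup>2)
        \<le> cmod (hinner V (compress (filter_matrix W) T f) f)"
      unfolding form norm_of_real by simp
    also have "\<dots> \<le> vnorm V (compress (filter_matrix W) T f) * vnorm V f"
      by (rule hinner_cauchy_schwarz)
    also have "\<dots> \<le> r * vnorm V f * vnorm V f"
      by (intro mult_right_mono assms vnorm_nonneg)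
    finally show ?thesis .
  qed
  finally show ?thesis by (simp add: power2_eq_square algebra_simps)
qed

end

section \<open>Bernoulli random subsets\<close>

definition random_subset :: "'a set \<Rightarrow> real \<Rightarrow> 'a set pmf" where
  "random_subset V p = map_pmf (\<lambda>I. {t \<in> V. I t}) (Pi_pmf V False (\<lambda>_. bernoulli_pmf p))"

lemma set_random_subset: "set_pmf (random_subset V p) \<subseteq> Pow V"
  by (auto simp: random_subset_def)

lemma pmf_random_subset:
  assumes "finite V" "S \<subseteq> V" "0 \<le> p" "p \<le> 1"
  shows "pmf (random_subset V p) S = p ^ card S * (1 - p) ^ card (V - S)"
proof -
  let ?M = "Pi_pmf V False (\<lambda>_. bernoulli_pmf p)"
  have "pmf (random_subset V p) S = measure_pmf.prob ?M ((\<lambda>I. {t \<in> V. I t}) -` {S})"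
    by (simp add: random_subset_def pmf_map)
  also have "\<dots> = measure_pmf.prob ?M {\<lambda>t. t \<in> S}"
  proof (rule measure_pmf.finite_measure_eq_AE, goal_cases)
    case 1
    show ?case
    proof (rule AE_pmfI)
      fix I assume "I \<in> set_pmf ?M"
      then have "\<not> I t" if "t \<notin> V" for t
        using set_Pi_pmf_subset[OF \<open>finite V\<close>, of False "\<lambda>_. bernoulli_pmf p"] that by auto
      then show "(I \<in> (\<lambda>I. {t \<in> V. I t}) -` {S}) = (I \<in> {\<lambda>t. t \<in> S})"
        using \<open>S \<subseteq> V\<close> by (auto simp: fun_eq_iff)
    qed
  qed simp_all
  also have "\<dots> = (\<Prod>t\<in>V. pmf (bernoulli_pmf p) (t \<in> S))"
    using assms by (subst measure_pmf_single, subst pmf_Pi') auto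
  also have "\<dots> = (\<Prod>t\<in>V. if t \<in> S then p else 1 - p)"
    using assms by (intro prod.cong) auto
  also have "\<dots> = p ^ card S * (1 - p) ^ card (V - S)"
    using assms by (simp add: prod.If_cases Int_absorb1 Diff_eq)
  finally show ?thesis .
qed

text \<open>
  Adding a point multiplies the probability by the odds \<open>p / (1 - p)\<close>, at most
  \<open>2 p\<close> here.
\<close>
lemma pmf_random_subset_insert:
  assumes "finite V" "S \<subseteq> V" "t \<in> V - S" "0 \<le> p" "p \<le> 1 / 2"
  shows "pmf (random_subset V p) (insert t S) \<le> 2 * p * pmf (random_subset V p) S"
proof -
  have "finite S" using assms finite_subset by blast
  define d where "d = card (V - insert t S)"
  have d: "card (V - S) = Suc d"
    unfolding d_def using assms by (metis Diff_insert card_Suc_Diff1 finite_Diff)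
  have "pmf (random_subset V p) S = p ^ card S * (1 - p) ^ Suc d"
    using assms by (simp add: pmf_random_subset d)
  moreover have "pmf (random_subset V p) (insert t S) = p ^ Suc (card S) * (1 - p) ^ d"
    unfolding d_def using assms \<open>finite S\<close> by (subst pmf_random_subset) auto
  ultimately have "2 * p * pmf (random_subset V p) S = (2 * (1 - p)) * pmf (random_subset V p) (insert t S)"
    by simp
  moreover have "1 * pmf (random_subset V p) (insert t S) \<le> (2 * (1 - p)) * pmf (random_subset V p) (insert t S)"
    using assms by (intro mult_right_mono) auto
  ultimately show ?thesis by simp
qed

lemma prob_random_subset:
  assumes "finite V"
  shows "measure_pmf.prob (random_subset V p) {T. P T} =
    (\<Sum>T | T \<subseteq> V \<and> P T. pmf (random_subset V p) T)"
proof -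
  have "measure_pmf.prob (random_subset V p) {T. P T} =
      measure_pmf.prob (random_subset V p) {T. T \<subseteq> V \<and> P T}"
    using set_random_subset[of V p]
    by (intro measure_pmf.finite_measure_eq_AE AE_pmfI) auto
  also have "\<dots> = (\<Sum>T | T \<subseteq> V \<and> P T. pmf (random_subset V p) T)"
    using assms by (intro measure_measure_pmf_finite) simp
  finally show ?thesis .
qed

lemma prob_random_subset_mono:
  assumes "\<And>T. T \<subseteq> V \<Longrightarrow> P T \<Longrightarrow> T \<in> B"
  shows "measure_pmf.prob (random_subset V p) {T. P T} \<le> measure_pmf.prob (random_subset V p) B"
  using assms set_random_subset[of V p]
  by (intro measure_pmf.finite_measure_mono_AE AE_pmfI) auto

text \<open>
  Hoeffding's inequality. An upper bound \<open>D\<close> in place of the sum of squares also covers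
  the case where all coefficients vanish.
\<close>
lemma random_subset_sum_tail:
  fixes a :: "'a \<Rightarrow> real"
  assumes "finite V" "0 \<le> p" "p \<le> 1" "0 < \<epsilon>" and D: "(\<Sum>t\<in>V. (a t)\<^sup>2) \<le> D"
  shows "measure_pmf.prob (random_subset V p) {T. (\<Sum>t\<in>T. a t) \<ge> p * (\<Sum>t\<in>V. a t) + \<epsilon>}
    \<le> exp (- 2 * \<epsilon>\<^sup>2 / D)"
proof -
  let ?M = "Pi_pmf V False (\<lambda>_. bernoulli_pmf p)"
  define X where "X t I = (if I t then a t else 0)" for t and I :: "'a \<Rightarrow> bool"
  have X_sum: "(\<Sum>t\<in>{t \<in> V. I t}. a t) = (\<Sum>t\<in>V. X t I)" for I
    using assms(1) by (simp add: X_def sum.inter_filter)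
  have eq: "measure_pmf.prob (random_subset V p) {T. (\<Sum>t\<in>T. a t) \<ge> p * (\<Sum>t\<in>V. a t) + \<epsilon>} =
      measure_pmf.prob ?M {I. (\<Sum>t\<in>V. X t I) \<ge> p * (\<Sum>t\<in>V. a t) + \<epsilon>}"
    by (simp add: random_subset_def X_sum vimage_def)
  show ?thesis
  proof (cases "(\<Sum>t\<in>V. (a t)\<^sup>2) = 0")
    case True
    then have "\<forall>t\<in>V. a t = 0" using assms(1) by (simp add: sum_nonneg_eq_0_iff)
    then have "(\<Sum>t\<in>V. X t I) = 0" for I
      by (intro sum.neutral) (simp add: X_def)
    then have "{I. (\<Sum>t\<in>V. X t I) \<ge> p * (\<Sum>t\<in>V. a t) + \<epsilon>} = {}"
      using \<open>0 < \<epsilon>\<close> \<open>\<forall>t\<in>V. a t = 0\<close> by simp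
    then show ?thesis unfolding eq by (simp only: measure_empty exp_ge_zero)
  next
    case False
    then have pos: "0 < (\<Sum>t\<in>V. (a t)\<^sup>2)" using sum_nonneg[of V "\<lambda>t. (a t)\<^sup>2"] by simp
    have mean: "measure_pmf.expectation ?M (X t) = p * a t" if "t \<in> V" for t
    proof -
      have "measure_pmf.expectation ?M (X t) =
          measure_pmf.expectation (map_pmf (\<lambda>I. I t) ?M) (\<lambda>b. if b then a t else 0)"
        by (simp add: X_def[abs_def])
      also have "map_pmf (\<lambda>I. I t) ?M = bernoulli_pmf p"
        using that assms(1) by (simp add: Pi_pmf_component)
      finally show ?thesis using assms by simp
    qed
    interpret Hoeffding_ineq ?M V X "\<lambda>t. min 0 (a t)" "\<lambda>t. max 0 (a t)" "p * (\<Sum>t\<in>V. a t)"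
    proof unfold_locales
      show "prob_space.indep_vars ?M (\<lambda>_. borel) X V"
        unfolding X_def using assms(1)
        by (intro prob_space.indep_vars_compose2[OF _ indep_vars_Pi_pmf])
          (auto simp: measure_pmf.prob_space_axioms)
      show "p * (\<Sum>t\<in>V. a t) \<equiv> (\<Sum>t\<in>V. measure_pmf.expectation ?M (X t))"
        by (rule eq_reflection) (simp add: sum_distrib_left mean)
    qed (use assms in \<open>auto simp: X_def\<close>)
    have range: "(max 0 (a t) - min 0 (a t))\<^sup>2 = (a t)\<^sup>2" for t
      by (simp add: max_def min_def)
    have "measure_pmf.prob ?M {I. (\<Sum>t\<in>V. X t I) \<ge> p * (\<Sum>t\<in>V. a t) + \<epsilon>}
        \<le> exp (- 2 * \<epsilon>\<^sup>2 / (\<Sum>t\<in>V. (a t)\<^sup>2))"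
      using Hoeffding_ineq_ge[of \<epsilon>] pos \<open>0 < \<epsilon>\<close> by (simp add: range)
    also have "\<dots> \<le> exp (- 2 * \<epsilon>\<^sup>2 / D)"
      using D pos by (simp add: frac_le)
    finally show ?thesis unfolding eq .
  qed
qed

text \<open>
  Conditioning on the second component: \<open>\<delta>\<close> bounds the probability when it is
  good, and 1 does otherwise.
\<close>
lemma prob_pair_le:
  assumes "\<And>y. G y \<Longrightarrow> measure_pmf.prob A {x. P x y} \<le> \<delta>" "0 \<le> \<delta>"
  shows "measure_pmf.prob (pair_pmf A B) {z. P (fst z) (snd z)} \<le> measure_pmf.prob B {y. \<not> G y} + \<delta>"
proof -
  have "ennreal (measure_pmf.prob (pair_pmf A B) {z. P (fst z) (snd z)}) =
      (\<integral>\<^sup>+z. indicator {z. P (fst z) (snd z)} z \<partial>pair_pmf A B)"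
    by (simp add: measure_pmf.emeasure_eq_measure[symmetric])
  also have "\<dots> = (\<integral>\<^sup>+z. indicator {z. P (fst z) (snd z)} (snd z, fst z) \<partial>pair_pmf B A)"
    by (subst pair_commute_pmf) (simp add: split_beta)
  also have "\<dots> = (\<integral>\<^sup>+y. \<integral>\<^sup>+x. indicator {z. P (fst z) (snd z)} (x, y) \<partial>A \<partial>B)"
    by (simp add: nn_integral_pair_pmf')
  also have "\<dots> = (\<integral>\<^sup>+y. emeasure A {x. P x y} \<partial>B)"
  proof (rule nn_integral_cong)
    fix y
    have "(\<lambda>x. indicator {z. P (fst z) (snd z)} (x, y)) = (indicator {x. P x y} :: _ \<Rightarrow> ennreal)"
      by (auto simp: indicator_def)
    then show "(\<integral>\<^sup>+x. indicator {z. P (fst z) (snd z)} (x, y) \<partial>A) = emeasure A {x. P x y}"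
      by simp
  qed
  also have "\<dots> \<le> (\<integral>\<^sup>+y. indicator {y. \<not> G y} y + ennreal \<delta> \<partial>B)"
  proof (rule nn_integral_mono)
    fix y
    show "emeasure A {x. P x y} \<le> indicator {y. \<not> G y} y + ennreal \<delta>"
    proof (cases "G y")
      case True
      then show ?thesis
        using assms by (simp add: measure_pmf.emeasure_eq_measure ennreal_leI)
    next
      case False
      have "emeasure A {x. P x y} \<le> 1" by (rule measure_pmf.emeasure_le_1)
      then show ?thesis using False by (simp add: add_increasing2)
    qed
  qed
  also have "\<dots> = ennreal (measure_pmf.prob B {y. \<not> G y} + \<delta>)"
    using \<open>0 \<le> \<delta>\<close> by (simp add: nn_integral_add measure_pmf.emeasure_eq_measure ennreal_plus)
  finally show ?thesis using \<open>0 \<le> \<delta>\<close> by (simp add: ennreal_le_iff del: ennreal_plus)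
qed

section \<open>Random time and frequency sets for a flat unitary matrix\<close>

context flat_unitary
begin

text \<open>
  An entry off the diagonal is the sum over \<open>W\<close> of coefficients of modulus
  \<open>1/N\<close> whose sum over \<open>V\<close> is 0, with \<open>N = card V\<close>; the
  same holds after multiplication with a unit \<open>u\<close>. If the real parts of the four
  products with \<open>u = 1, -1, \<i>, -\<i>\<close> are below \<open>\<eta>/2\<close>, the
  modulus is below \<open>\<eta>\<close>.
\<close>
lemma filter_entries_prob:
  assumes "0 \<le> p" "p \<le> 1" "0 < \<eta>"
  shows "measure_pmf.prob (random_subset V p)
      {W. \<not> (sampling_ratio W \<le> p + \<eta> \<and>
        (\<forall>i\<in>V. \<forall>j\<in>V. i \<noteq> j \<longrightarrow> cmod (filter_matrix W i j) \<le> \<eta>))}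
    \<le> 5 * (real (card V))\<^sup>2 * exp (- real (card V) * \<eta>\<^sup>2 / 2)"
proof -
  let ?M = "random_subset V p" and ?N = "real (card V)"
  let ?K = "exp (- ?N * \<eta>\<^sup>2 / 2)"
  define E0 where "E0 = {W :: 'a set. (\<Sum>w\<in>W. 1) \<ge> p * (\<Sum>w\<in>V. 1) + ?N * \<eta>}"
  define z where "z i j w = cnj (U w i) * U w j" for i j w
  define E where "E s = (case s of (i, j, u) \<Rightarrow>
      {W. (\<Sum>w\<in>W. Re (u * z i j w)) \<ge> p * (\<Sum>w\<in>V. Re (u * z i j w)) + \<eta> / 2})" for s
  define I where "I = {(i, j, u). i \<in> V \<and> j \<in> V \<and> i \<noteq> j \<and> u \<in> {1, - 1, \<i>, - \<i>}}"
  have I_sub: "I \<subseteq> V \<times> V \<times> {1, - 1, \<i>, - \<i>}" by (auto simp: I_def)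
  have fin_I: "finite I" using finite_subset[OF I_sub] finite_V by simp
  have "card I \<le> card (V \<times> V \<times> {1, - 1, \<i>, - \<i>})"
    using I_sub finite_V by (intro card_mono) auto
  also have "\<dots> \<le> card V * (card V * 4)"
    unfolding card_cartesian_product by (intro mult_le_mono2) (simp add: card_insert_if)
  finally have card_I: "real (card I) \<le> 4 * ?N\<^sup>2"
    by (simp add: power2_eq_square flip: of_nat_mult)
  have N: "1 \<le> ?N" using card_V_pos by simp
  have "measure_pmf.prob ?M E0 \<le> exp (- 2 * (?N * \<eta>)\<^sup>2 / ?N)"
    unfolding E0_def using assms finite_V card_V_pos by (intro random_subset_sum_tail) auto
  also have "\<dots> \<le> ?K" using N by (simp add: power_mult_distrib power2_eq_square)
  finally have E0_le: "measure_pmf.prob ?M E0 \<le> ?K" .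
  have E_le: "measure_pmf.prob ?M (E s) \<le> ?K" if "s \<in> I" for s
  proof -
    obtain i j u where s: "s = (i, j, u)" "i \<in> V" "j \<in> V" and u: "cmod u = 1"
      using \<open>s \<in> I\<close> by (auto simp: I_def)
    have "(\<Sum>w\<in>V. (Re (u * z i j w))\<^sup>2) \<le> (\<Sum>w\<in>V. (1 / ?N)\<^sup>2)"
    proof (rule sum_mono)
      fix w assume "w \<in> V"
      have "(Re (u * z i j w))\<^sup>2 \<le> (cmod (u * z i j w))\<^sup>2"
        by (rule abs_le_square_iff[THEN iffD1]) (simp only: abs_norm_cancel abs_Re_le_cmod)
      also have "\<dots> = (cmod (U w i))\<^sup>2 * (cmod (U w j))\<^sup>2"
        by (simp add: u z_def norm_mult power_mult_distrib)
      also have "\<dots> = (1 / ?N)\<^sup>2"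
        unfolding flat[OF \<open>w \<in> V\<close> s(2)] flat[OF \<open>w \<in> V\<close> s(3)] by (simp add: power2_eq_square)
      finally show "(Re (u * z i j w))\<^sup>2 \<le> (1 / ?N)\<^sup>2" .
    qed
    then have "(\<Sum>w\<in>V. (Re (u * z i j w))\<^sup>2) \<le> 1 / ?N"
      using N by (simp add: power2_eq_square)
    then have "measure_pmf.prob ?M (E s) \<le> exp (- 2 * (\<eta> / 2)\<^sup>2 / (1 / ?N))"
      unfolding E_def s(1) prod.case using assms finite_V by (intro random_subset_sum_tail) auto
    then show ?thesis by (simp add: power_divide mult_ac)
  qed
  have cover: "W \<in> E0 \<union> (\<Union>s\<in>I. E s)"
    if "W \<subseteq> V" and bad: "\<not> (sampling_ratio W \<le> p + \<eta> \<and>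
        (\<forall>i\<in>V. \<forall>j\<in>V. i \<noteq> j \<longrightarrow> cmod (filter_matrix W i j) \<le> \<eta>))" for W
  proof (rule ccontr)
    assume "W \<notin> E0 \<union> (\<Union>s\<in>I. E s)"
    then have not_E0: "W \<notin> E0" and not_E: "\<And>s. s \<in> I \<Longrightarrow> W \<notin> E s" by auto
    have "card W < (p + \<eta>) * ?N" using not_E0 by (simp add: E0_def algebra_simps)
    then have "sampling_ratio W \<le> p + \<eta>"
      using N by (simp add: sampling_ratio_def pos_divide_le_eq)
    then obtain i j where ij: "i \<in> V" "j \<in> V" "i \<noteq> j" and large: "\<eta> < cmod (filter_matrix W i j)"
      using bad by (auto simp: not_le)
    have zero: "(\<Sum>w\<in>V. z i j w) = 0"
      unfolding z_def using orthonormal_columns[OF ij(2,1)] ij(3) by (simp add: mult.commute)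
    have entry: "filter_matrix W i j = (\<Sum>w\<in>W. z i j w)"
      unfolding z_def using ij by (intro filter_offdiag \<open>W \<subseteq> V\<close>)
    have "Re (u * filter_matrix W i j) < \<eta> / 2" if "u \<in> {1, - 1, \<i>, - \<i>}" for u
    proof -
      have "(i, j, u) \<in> I" using ij that by (simp add: I_def)
      then have "(\<Sum>w\<in>W. Re (u * z i j w)) < p * (\<Sum>w\<in>V. Re (u * z i j w)) + \<eta> / 2"
        using not_E by (force simp: E_def)
      moreover have "(\<Sum>w\<in>S. Re (u * z i j w)) = Re (u * (\<Sum>w\<in>S. z i j w))" for S
        by (simp add: sum_distrib_left)
      ultimately show ?thesis by (simp add: entry zero del: times_complex.sel)
    qed
    from this[of 1] this[of "- 1"] this[of \<i>] this[of "- \<i>"]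
    have "\<bar>Re (filter_matrix W i j)\<bar> < \<eta> / 2" "\<bar>Im (filter_matrix W i j)\<bar> < \<eta> / 2"
      by auto
    then show False using cmod_le[of "filter_matrix W i j"] large by linarith
  qed
  have "measure_pmf.prob ?M (\<Union>s\<in>I. E s) \<le> (\<Sum>s\<in>I. measure_pmf.prob ?M (E s))"
    using fin_I by (intro measure_pmf.finite_measure_subadditive_finite) simp_all
  also have "\<dots> \<le> card I * ?K"
    by (rule sum_bounded_above) (rule E_le)
  also have "\<dots> \<le> 4 * ?N\<^sup>2 * ?K" using card_I by (intro mult_right_mono) simp_all
  finally have E_Un_le: "measure_pmf.prob ?M (\<Union>s\<in>I. E s) \<le> 4 * ?N\<^sup>2 * ?K" .
  have "1 * ?K \<le> ?N\<^sup>2 * ?K" using N by (intro mult_right_mono) simp_all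
  then have E0_le': "measure_pmf.prob ?M E0 \<le> ?N\<^sup>2 * ?K" using E0_le by linarith
  have "measure_pmf.prob ?M {W. \<not> (sampling_ratio W \<le> p + \<eta> \<and>
        (\<forall>i\<in>V. \<forall>j\<in>V. i \<noteq> j \<longrightarrow> cmod (filter_matrix W i j) \<le> \<eta>))}
      \<le> measure_pmf.prob ?M (E0 \<union> (\<Union>s\<in>I. E s))"
    by (rule prob_random_subset_mono) (rule cover)
  also have "\<dots> \<le> measure_pmf.prob ?M E0 + measure_pmf.prob ?M (\<Union>s\<in>I. E s)"
    by (rule measure_Un_le) simp_all
  also have "\<dots> \<le> ?N\<^sup>2 * ?K + 4 * ?N\<^sup>2 * ?K"
    by (intro add_mono E0_le' E_Un_le)
  finally show ?thesis by (simp add: algebra_simps)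
qed

text \<open>
  The squared moduli in a column are at most \<open>\<eta>\<^sup>2\<close> and add up to at most 1,
  so the sum of their squares, which governs the deviation in Hoeffding's inequality, is at most
  \<open>\<eta>\<^sup>2\<close>.
\<close>
lemma small_columns_prob:
  assumes "W \<subseteq> V" "0 \<le> p" "p \<le> 1" "0 < \<epsilon>" "0 < \<eta>"
    and entries: "\<And>i j. i \<in> V \<Longrightarrow> j \<in> V \<Longrightarrow> i \<noteq> j \<Longrightarrow> cmod (filter_matrix W i j) \<le> \<eta>"
    and R: "p * sampling_ratio W + \<epsilon> \<le> R"
  shows "measure_pmf.prob (random_subset V p) {T. T \<notin> small_column_sets V (filter_matrix W) R}
    \<le> card V * exp (- 2 * \<epsilon>\<^sup>2 / \<eta>\<^sup>2)"
proof -
  let ?M = "random_subset V p"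
  define a where "a t j = (cmod (filter_matrix W j t))\<^sup>2" for t j
  define E where "E t = {T. (\<Sum>j\<in>T. a t j) \<ge> p * (\<Sum>j\<in>V. a t j) + \<epsilon>}" for t
  have a_sum: "(\<Sum>j\<in>V. a t j) \<le> sampling_ratio W" if "t \<in> V" for t
    unfolding a_def by (rule filter_column_sum[OF \<open>W \<subseteq> V\<close> that])
  have E_le: "measure_pmf.prob ?M (E t) \<le> exp (- 2 * \<epsilon>\<^sup>2 / \<eta>\<^sup>2)" if "t \<in> V" for t
    unfolding E_def
  proof (rule random_subset_sum_tail)
    have "(\<Sum>j\<in>V. (a t j)\<^sup>2) \<le> (\<Sum>j\<in>V. \<eta>\<^sup>2 * a t j)"
    proof (rule sum_mono)
      fix j assume "j \<in> V"
      have "a t j \<le> \<eta>\<^sup>2"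
        using entries[OF \<open>j \<in> V\<close> \<open>t \<in> V\<close>] filter_hollow[OF \<open>W \<subseteq> V\<close> \<open>t \<in> V\<close>] \<open>0 < \<eta>\<close>
        unfolding a_def by (cases "j = t") (auto intro: power_mono)
      then show "(a t j)\<^sup>2 \<le> \<eta>\<^sup>2 * a t j"
        unfolding power2_eq_square by (intro mult_right_mono) (simp_all add: a_def)
    qed
    also have "\<dots> = \<eta>\<^sup>2 * (\<Sum>j\<in>V. a t j)" by (rule sum_distrib_left[symmetric])
    also have "\<dots> \<le> \<eta>\<^sup>2 * 1"
      using a_sum[OF that] sampling_ratio_bounds[OF \<open>W \<subseteq> V\<close>] by (intro mult_left_mono) auto
    finally show "(\<Sum>j\<in>V. (a t j)\<^sup>2) \<le> \<eta>\<^sup>2" by simp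
  qed (use assms finite_V in auto)
  have cover: "T \<in> (\<Union>t\<in>V. E t)"
    if T: "T \<subseteq> V" "T \<notin> small_column_sets V (filter_matrix W) R" for T
  proof -
    obtain t where t: "t \<in> T" "R < (\<Sum>j\<in>T. a t j)"
      using T by (auto simp: small_column_sets_def a_def not_le)
    then have "t \<in> V" using T(1) by auto
    then have "p * (\<Sum>j\<in>V. a t j) \<le> p * sampling_ratio W"
      using a_sum \<open>0 \<le> p\<close> by (intro mult_left_mono) auto
    then have "T \<in> E t" using t R by (simp add: E_def)
    then show ?thesis using \<open>t \<in> V\<close> by auto
  qed
  have "measure_pmf.prob ?M {T. T \<notin> small_column_sets V (filter_matrix W) R}
      \<le> measure_pmf.prob ?M (\<Union>t\<in>V. E t)"
    by (rule prob_random_subset_mono) (rule cover)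
  also have "\<dots> \<le> (\<Sum>t\<in>V. measure_pmf.prob ?M (E t))"
    using finite_V by (intro measure_pmf.finite_measure_subadditive_finite) simp_all
  also have "\<dots> \<le> card V * exp (- 2 * \<epsilon>\<^sup>2 / \<eta>\<^sup>2)"
    by (rule sum_bounded_above) (rule E_le)
  finally show ?thesis .
qed

definition concentrated_pair :: "'a set \<Rightarrow> 'a set \<Rightarrow> bool" where
  "concentrated_pair T W \<longleftrightarrow> (\<exists>f. (\<forall>t. t \<notin> T \<longrightarrow> f t = 0) \<and>
    (vnorm V f)\<^sup>2 / 2 < (\<Sum>w\<in>W. (cmod (transform f w))\<^sup>2))"

text \<open>
  The permitted fraction \<open>1/2\<close> of the energy is split evenly: \<open>1/4\<close> for
  the sampling ratio and \<open>1/4\<close> for the compression. The choice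
  \<open>B = 1/(4e)\<close> makes the tail bound decay like
  \<open>e\<^sup>-\<^sup>2\<^sup>n\<close>.
\<close>
lemma concentrated_pair_prob_fixed_filter:
  assumes "W \<subseteq> V" "sampling_ratio W \<le> 1 / 4" "0 \<le> p" "p \<le> 1 / 2" "0 < \<epsilon>" "0 < \<eta>"
    and entries: "\<And>i j. i \<in> V \<Longrightarrow> j \<in> V \<Longrightarrow> i \<noteq> j \<Longrightarrow> cmod (filter_matrix W i j) \<le> \<eta>"
    and R: "p * sampling_ratio W + \<epsilon> \<le> R"
    and small: "2 * p * (1 + R / (exp (- 1) / 4)\<^sup>2) ^ (2 * n) \<le> (exp (- 1) / 4)\<^sup>2"
  shows "measure_pmf.prob (random_subset V p) {T. concentrated_pair T W}
    \<le> card V * exp (- 2 * \<epsilon>\<^sup>2 / \<eta>\<^sup>2) + card V * exp (- 2 * real n)"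
proof -
  let ?M = "random_subset V p" and ?H = "filter_matrix W"
  let ?G = "small_column_sets V ?H R"
  let ?bad = "\<lambda>T. \<exists>f. (\<forall>t. t \<notin> T \<longrightarrow> f t = 0) \<and> 1 / 4 * vnorm V f < vnorm V (compress ?H T f)"
  interpret hermitian_form V ?H by (rule hermitian_filter)
  have "0 \<le> R"
    using R assms sampling_ratio_bounds[OF \<open>W \<subseteq> V\<close>] mult_nonneg_nonneg[of p "sampling_ratio W"]
    by linarith
  have cover: "T \<in> {T. T \<notin> ?G} \<union> {T. T \<in> ?G \<and> ?bad T}" if T: "T \<subseteq> V" "concentrated_pair T W" for T
  proof (rule ccontr)
    assume "T \<notin> {T. T \<notin> ?G} \<union> {T. T \<in> ?G \<and> ?bad T}"
    then have "\<not> ?bad T" by blast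
    obtain f where supp: "\<And>t. t \<notin> T \<Longrightarrow> f t = 0"
      and f: "(vnorm V f)\<^sup>2 / 2 < (\<Sum>w\<in>W. (cmod (transform f w))\<^sup>2)"
      using T(2) by (auto simp: concentrated_pair_def)
    then have "vnorm V (compress ?H T f) \<le> 1 / 4 * vnorm V f"
      using \<open>\<not> ?bad T\<close> by (meson not_le)
    then have "(\<Sum>w\<in>W. (cmod (transform f w))\<^sup>2) \<le> (sampling_ratio W + 1 / 4) * (vnorm V f)\<^sup>2"
      using T(1) supp \<open>W \<subseteq> V\<close> by (intro concentration_from_compression) auto
    also have "\<dots> \<le> 1 / 2 * (vnorm V f)\<^sup>2"
      using assms(2) by (intro mult_right_mono) auto
    finally show False using f by simp
  qed
  have "measure_pmf.prob ?M {T. concentrated_pair T W}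
      \<le> measure_pmf.prob ?M ({T. T \<notin> ?G} \<union> {T. T \<in> ?G \<and> ?bad T})"
    by (rule prob_random_subset_mono) (rule cover)
  also have "\<dots> \<le> measure_pmf.prob ?M {T. T \<notin> ?G} + measure_pmf.prob ?M {T. T \<in> ?G \<and> ?bad T}"
    by (rule measure_Un_le) simp_all
  also have "\<dots> \<le> card V * exp (- 2 * \<epsilon>\<^sup>2 / \<eta>\<^sup>2) + card V * exp (- 2 * real n)"
  proof (rule add_mono)
    show "measure_pmf.prob ?M {T. T \<notin> ?G} \<le> card V * exp (- 2 * \<epsilon>\<^sup>2 / \<eta>\<^sup>2)"
      using assms by (intro small_columns_prob) auto
    have "{T. T \<subseteq> V \<and> T \<in> ?G \<and> ?bad T} = {T. T \<in> ?G \<and> ?bad T}"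
      by (auto simp: small_column_sets_def)
    then have "measure_pmf.prob ?M {T. T \<in> ?G \<and> ?bad T} = (\<Sum>T | T \<in> ?G \<and> ?bad T. pmf ?M T)"
      using prob_random_subset[OF finite_V, of p "\<lambda>T. T \<in> ?G \<and> ?bad T"] by simp
    also have "\<dots> \<le> card V * ((exp (- 1) / 4) / (1 / 4)) ^ (2 * n)"
    proof (rule compression_tail[OF filter_contraction[OF \<open>W \<subseteq> V\<close>] filter_hollow[OF \<open>W \<subseteq> V\<close>]
          pmf_nonneg _ _ _ _ \<open>0 \<le> R\<close> small])
      show "(\<Sum>S\<in>Pow V. pmf ?M S) \<le> 1"
        using finite_V by (subst measure_measure_pmf_finite[symmetric]) auto
      show "pmf ?M (insert t S) \<le> 2 * p * pmf ?M S" if "S \<subseteq> V" "t \<in> V - S" for S t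
        using that assms finite_V by (intro pmf_random_subset_insert) auto
    qed (use assms in auto)
    also have "((exp (- 1) / 4) / (1 / 4)) ^ (2 * n) = exp (- 2 * real n)"
      by (simp flip: exp_of_nat_mult)
    finally show "measure_pmf.prob ?M {T. T \<in> ?G \<and> ?bad T} \<le> card V * exp (- 2 * real n)" .
  qed
  finally show ?thesis .
qed

lemma concentrated_pair_prob:
  assumes "0 \<le> pT" "pT \<le> 1 / 2" "0 \<le> pW" "pW \<le> 1" "0 < \<epsilon>" "0 < \<eta>" "pW + \<eta> \<le> 1 / 4"
    and R: "pT * (pW + \<eta>) + \<epsilon> \<le> R"
    and small: "2 * pT * (1 + R / (exp (- 1) / 4)\<^sup>2) ^ (2 * n) \<le> (exp (- 1) / 4)\<^sup>2"
  shows "measure_pmf.prob (pair_pmf (random_subset V pT) (random_subset V pW))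
      {z. fst z \<subseteq> V \<and> snd z \<subseteq> V \<and> concentrated_pair (fst z) (snd z)}
    \<le> 5 * (real (card V))\<^sup>2 * exp (- real (card V) * \<eta>\<^sup>2 / 2) +
      (card V * exp (- 2 * \<epsilon>\<^sup>2 / \<eta>\<^sup>2) + card V * exp (- 2 * real n))"
proof -
  define G where "G W \<longleftrightarrow> sampling_ratio W \<le> pW + \<eta> \<and>
      (\<forall>i\<in>V. \<forall>j\<in>V. i \<noteq> j \<longrightarrow> cmod (filter_matrix W i j) \<le> \<eta>)" for W
  let ?\<delta> = "card V * exp (- 2 * \<epsilon>\<^sup>2 / \<eta>\<^sup>2) + card V * exp (- 2 * real n)"
  have "measure_pmf.prob (pair_pmf (random_subset V pT) (random_subset V pW))
      {z. fst z \<subseteq> V \<and> snd z \<subseteq> V \<and> concentrated_pair (fst z) (snd z)}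
    \<le> measure_pmf.prob (random_subset V pW) {W. \<not> G W} + ?\<delta>"
  proof (rule prob_pair_le)
    fix W assume "G W"
    show "measure_pmf.prob (random_subset V pT) {T. T \<subseteq> V \<and> W \<subseteq> V \<and> concentrated_pair T W} \<le> ?\<delta>"
    proof (cases "W \<subseteq> V")
      case True
      have "pT * sampling_ratio W \<le> pT * (pW + \<eta>)"
        using \<open>G W\<close> assms by (intro mult_left_mono) (auto simp: G_def)
      then have "measure_pmf.prob (random_subset V pT) {T. concentrated_pair T W} \<le> ?\<delta>"
        using \<open>G W\<close> True assms
        by (intro concentrated_pair_prob_fixed_filter[OF True]) (auto simp: G_def)
      moreover have "measure_pmf.prob (random_subset V pT) {T. T \<subseteq> V \<and> W \<subseteq> V \<and> concentrated_pair T W}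
          \<le> measure_pmf.prob (random_subset V pT) {T. concentrated_pair T W}"
        by (intro measure_pmf.finite_measure_mono) auto
      ultimately show ?thesis by linarith
    qed simp
  qed simp
  moreover have "measure_pmf.prob (random_subset V pW) {W. \<not> G W}
      \<le> 5 * (real (card V))\<^sup>2 * exp (- real (card V) * \<eta>\<^sup>2 / 2)"
    unfolding G_def using assms by (intro filter_entries_prob) auto
  ultimately show ?thesis by linarith
qed

end

section \<open>The discrete Fourier transform\<close>

definition fourier_matrix :: "nat \<Rightarrow> nat \<Rightarrow> nat \<Rightarrow> complex" where
  "fourier_matrix N w t = 1 / of_real (sqrt (real N)) *
     exp (- \<i> * of_real (2 * pi * real w * real t / real N))"

lemma sum_roots_of_unity:
  fixes d :: int
  assumes "0 < N" "\<not> int N dvd d"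
  shows "(\<Sum>t<N. exp (\<i> * of_real (2 * pi * real_of_int d * real t / real N))) = 0"
proof -
  define z where "z = exp (\<i> * of_real (2 * pi * real_of_int d / real N))"
  have "z ^ t = exp (\<i> * of_real (2 * pi * real_of_int d * real t / real N))" for t
    unfolding z_def by (simp add: exp_of_nat_mult[symmetric] mult_ac)
  then have sum: "(\<Sum>t<N. exp (\<i> * of_real (2 * pi * real_of_int d * real t / real N))) = (\<Sum>t<N. z ^ t)"
    by simp
  have "z \<noteq> 1"
  proof
    assume "z = 1"
    then obtain n :: int where n: "2 * pi * real_of_int d / real N = of_int (2 * n) * pi"
      unfolding z_def exp_eq_1 by auto
    then have "real_of_int d = real_of_int (n * int N)"
      using \<open>0 < N\<close> by (simp add: field_simps)
    then have "d = n * int N" by linarith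
    then show False using assms(2) by simp
  qed
  moreover have "z ^ N = 1"
  proof -
    have "z ^ N = exp (\<i> * of_real (2 * pi * real_of_int d))"
      unfolding z_def using \<open>0 < N\<close> by (simp add: exp_of_nat_mult[symmetric])
    also have "\<dots> = 1" unfolding exp_eq_1 by (auto intro!: exI[of _ d])
    finally show ?thesis .
  qed
  ultimately show ?thesis unfolding sum by (simp add: geometric_sum)
qed

lemma fourier_rows:
  assumes "w < N" "w' < N"
  shows "(\<Sum>t<N. fourier_matrix N w t * cnj (fourier_matrix N w' t)) = of_bool (w = w')"
proof -
  have N: "0 < N" using assms by simp
  have "fourier_matrix N w t * cnj (fourier_matrix N w' t) =
      1 / of_nat N * exp (\<i> * of_real (2 * pi * real_of_int (int w' - int w) * real t / real N))" for t
  proof -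
    have "fourier_matrix N w t * cnj (fourier_matrix N w' t) =
        (1 / (of_real (sqrt (real N)) * of_real (sqrt (real N)))) *
        (exp (- \<i> * of_real (2 * pi * real w * real t / real N)) *
         exp (\<i> * of_real (2 * pi * real w' * real t / real N)))"
      by (simp add: fourier_matrix_def exp_cnj)
    also have "of_real (sqrt (real N)) * of_real (sqrt (real N)) = (of_nat N :: complex)"
      by (simp flip: of_real_mult)
    also have "exp (- \<i> * of_real (2 * pi * real w * real t / real N)) *
         exp (\<i> * of_real (2 * pi * real w' * real t / real N)) =
         exp (\<i> * of_real (2 * pi * real_of_int (int w' - int w) * real t / real N))"
      unfolding exp_add[symmetric] by (simp add: algebra_simps diff_divide_distrib)
    finally show ?thesis .
  qed
  then have *: "(\<Sum>t<N. fourier_matrix N w t * cnj (fourier_matrix N w' t)) = 1 / of_nat N *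
      (\<Sum>t<N. exp (\<i> * of_real (2 * pi * real_of_int (int w' - int w) * real t / real N)))"
    by (simp add: sum_distrib_left)
  show ?thesis
  proof (cases "w = w'")
    case True
    then show ?thesis unfolding * using N by simp
  next
    case False
    have "\<not> int N dvd int w' - int w"
    proof
      assume "int N dvd int w' - int w"
      then have "int w' mod int N = int w mod int N" by (simp add: mod_eq_dvd_iff)
      then show False using assms False by simp
    qed
    then show ?thesis unfolding * by (subst sum_roots_of_unity[OF N]) (simp_all add: False)
  qed
qed

lemma fourier_matrix_sym: "fourier_matrix N w t = fourier_matrix N t w"
  by (simp add: fourier_matrix_def mult_ac)

lemma flat_unitary_fourier:
  assumes "0 < N"
  shows "flat_unitary {..<N} (fourier_matrix N)"
proof
  show "(\<Sum>w\<in>{..<N}. fourier_matrix N w t * cnj (fourier_matrix N w t')) = of_bool (t = t')"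
    if "t \<in> {..<N}" "t' \<in> {..<N}" for t t'
    using fourier_rows[of t N t'] that by (simp add: fourier_matrix_sym[of N _ t] fourier_matrix_sym[of N _ t'])
  show "(cmod (fourier_matrix N w t))\<^sup>2 = 1 / real (card {..<N})" for w t
    by (simp add: fourier_matrix_def norm_mult norm_divide power_mult_distrib power_divide)
qed (use assms in \<open>auto simp: fourier_rows\<close>)

text \<open>
  The bound for frequencies is dual to the one for times: if \<open>g\<close> is the restriction of
  \<open>f\<close> to \<open>T\<close>, then
  \<open>\<parallel>g\<parallel>\<^sup>2 = \<langle>g, f\<rangle>\<close> only sees the transform
  of \<open>g\<close> on \<open>W\<close>, to which the bound for times applies.
\<close>
lemma robust_uncertainty_if_not_concentrated:
  assumes "0 < N" "T \<subseteq> {..<N}" "W \<subseteq> {..<N}"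
    and not_conc: "\<not> flat_unitary.concentrated_pair {..<N} (fourier_matrix N) T W"
  shows "robust_uncertainty N T W"
proof -
  interpret flat_unitary "{..<N}" "fourier_matrix N" by (rule flat_unitary_fourier[OF \<open>0 < N\<close>])
  let ?V = "{..<N}"
  have dft: "dft N f w = transform f w" if "w < N" for f w
    using that by (simp add: dft_def transform_def fourier_matrix_def sum_distrib_left mult_ac)
  have norm: "signal_norm N f = vnorm ?V f" for f
    by (simp add: signal_norm_def vnorm_def)
  have norm_dft: "signal_norm N (dft N f) = vnorm ?V f" for f
  proof -
    have "signal_norm N (dft N f) = vnorm ?V (transform f)"
      unfolding norm vnorm_def by (intro L2_set_cong) (simp_all add: dft)
    then show ?thesis by (simp only: vnorm_transform)
  qed
  have norm_mult: "(signal_norm N (mult_indicator g S))\<^sup>2 = (\<Sum>w\<in>S. (cmod (g w))\<^sup>2)"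
    if "S \<subseteq> ?V" for g S
    unfolding norm vnorm_sq mult_indicator_def using that
    by (intro sum.mono_neutral_cong_right) (auto simp: indicator_def)
  have time: "(signal_norm N (mult_indicator (dft N f) W))\<^sup>2 \<le> (signal_norm N (dft N f))\<^sup>2 / 2"
    if "supported_on f T" for f
  proof -
    have "(\<Sum>w\<in>W. (cmod (transform f w))\<^sup>2) \<le> (vnorm ?V f)\<^sup>2 / 2"
      using not_conc that by (auto simp: concentrated_pair_def supported_on_def not_less)
    moreover have "(\<Sum>w\<in>W. (cmod (dft N f w))\<^sup>2) = (\<Sum>w\<in>W. (cmod (transform f w))\<^sup>2)"
      using \<open>W \<subseteq> ?V\<close> by (intro sum.cong) (auto simp: dft)
    ultimately show ?thesis using norm_mult[OF \<open>W \<subseteq> ?V\<close>] by (simp add: norm_dft)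
  qed
  have freq: "(signal_norm N (mult_indicator f T))\<^sup>2 \<le> (signal_norm N f)\<^sup>2 / 2"
    if "supported_on (dft N f) W" for f
  proof -
    define g where "g = mult_indicator f T"
    have g: "supported_on g T" by (simp add: g_def mult_indicator_def supported_on_def)
    let ?a = "vnorm ?V g" and ?b = "vnorm ?V (mult_indicator (dft N g) W)" and ?c = "vnorm ?V f"
    have "hinner ?V g f = hinner ?V g g"
      unfolding hinner_def g_def mult_indicator_def by (intro sum.cong) (auto simp: indicator_def)
    then have "of_real (?a\<^sup>2) = hinner ?V (transform g) (transform f)"
      by (simp only: hinner_self hinner_transform)
    also have "\<dots> = hinner ?V (mult_indicator (dft N g) W) (transform f)"
      unfolding hinner_def mult_indicator_def
    proof (intro sum.cong refl)
      fix w assume "w \<in> ?V"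
      then show "transform g w * cnj (transform f w) = dft N g w * indicator W w * cnj (transform f w)"
        using that dft[of w f] dft[of w g] by (auto simp: supported_on_def indicator_def)
    qed
    finally have "?a\<^sup>2 = cmod (hinner ?V (mult_indicator (dft N g) W) (transform f))"
      by (metis abs_of_nonneg norm_of_real zero_le_power2)
    also have "\<dots> \<le> ?b * ?c"
      using hinner_cauchy_schwarz by (metis vnorm_transform)
    finally have "(?a\<^sup>2)\<^sup>2 \<le> (?b * ?c)\<^sup>2" by (intro power_mono) auto
    also have "\<dots> = ?b\<^sup>2 * ?c\<^sup>2" by (rule power_mult_distrib)
    also have "\<dots> \<le> (?a\<^sup>2 / 2) * ?c\<^sup>2"
      using time[OF g] by (intro mult_right_mono) (simp_all add: norm norm_dft[unfolded norm])
    finally have "?a\<^sup>2 * ?a\<^sup>2 \<le> ?a\<^sup>2 * (?c\<^sup>2 / 2)" by (simp add: power2_eq_square)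
    then have "?a\<^sup>2 \<le> ?c\<^sup>2 / 2"
      by (cases "?a = 0") (simp, subst (asm) mult_le_cancel_left_pos, simp_all)
    then show ?thesis by (simp add: norm g_def)
  qed
  have "f = (\<lambda>_. 0)" if "f \<in> signals N" "supported_on f T" "supported_on (dft N f) W" for f
  proof -
    have "mult_indicator (dft N f) W = dft N f"
      using that(3) by (auto simp: mult_indicator_def supported_on_def indicator_def fun_eq_iff)
    then have "(signal_norm N (dft N f))\<^sup>2 \<le> 0" using time[OF that(2)] by simp
    then have "vnorm ?V f = 0" by (simp add: norm_dft)
    then have "\<forall>t<N. f t = 0" by (simp add: vnorm_def L2_set_eq_0_iff)
    then have "f t = 0" for t
      using that(1) by (cases "t < N") (simp_all add: signals_def)
    then show ?thesis by auto
  qed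
  then show ?thesis
    unfolding robust_uncertainty_def using time freq by blast
qed

lemma bernoulli_model_sets:
  "map_pmf (\<lambda>I. (time_set N I, freq_set N I)) (bernoulli_model N pT pW) =
    pair_pmf (random_subset {..<N} pT) (random_subset {..<N} pW)"
  unfolding bernoulli_model_def random_subset_def time_set_def freq_set_def
  by (simp add: map_pair[symmetric] map_prod_def case_prod_unfold)

lemma robust_uncertainty_prob:
  fixes \<epsilon> \<eta> R :: real
  assumes "0 < N" "0 \<le> pT" "pT \<le> 1 / 2" "0 \<le> pW" "pW \<le> 1" "0 < \<epsilon>" "0 < \<eta>" "pW + \<eta> \<le> 1 / 4"
    and R: "pT * (pW + \<eta>) + \<epsilon> \<le> R"
    and small: "2 * pT * (1 + R / (exp (- 1) / 4)\<^sup>2) ^ (2 * n) \<le> (exp (- 1) / 4)\<^sup>2"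
  shows "1 - (5 * (real N)\<^sup>2 * exp (- real N * \<eta>\<^sup>2 / 2) +
      (N * exp (- 2 * \<epsilon>\<^sup>2 / \<eta>\<^sup>2) + N * exp (- 2 * real n)))
    \<le> measure_pmf.prob (bernoulli_model N pT pW)
        {I. robust_uncertainty N (time_set N I) (freq_set N I)}"
proof -
  interpret flat_unitary "{..<N}" "fourier_matrix N" by (rule flat_unitary_fourier[OF \<open>0 < N\<close>])
  let ?M = "bernoulli_model N pT pW"
  let ?bad = "{z. fst z \<subseteq> {..<N} \<and> snd z \<subseteq> {..<N} \<and> concentrated_pair (fst z) (snd z)}"
  have "measure_pmf.prob ?M {I. \<not> robust_uncertainty N (time_set N I) (freq_set N I)}
      \<le> measure_pmf.prob ?M ((\<lambda>I. (time_set N I, freq_set N I)) -` ?bad)"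
  proof (intro measure_pmf.finite_measure_mono subsetI)
    fix I assume "I \<in> {I. \<not> robust_uncertainty N (time_set N I) (freq_set N I)}"
    moreover have "time_set N I \<subseteq> {..<N}" "freq_set N I \<subseteq> {..<N}"
      by (auto simp: time_set_def freq_set_def)
    ultimately show "I \<in> (\<lambda>I. (time_set N I, freq_set N I)) -` ?bad"
      using robust_uncertainty_if_not_concentrated[OF \<open>0 < N\<close>] by auto
  qed simp
  also have "\<dots> = measure_pmf.prob (map_pmf (\<lambda>I. (time_set N I, freq_set N I)) ?M) ?bad"
    by simp
  also have "\<dots> \<le> 5 * (real N)\<^sup>2 * exp (- real N * \<eta>\<^sup>2 / 2) +
      (N * exp (- 2 * \<epsilon>\<^sup>2 / \<eta>\<^sup>2) + N * exp (- 2 * real n))"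
    unfolding bernoulli_model_sets using concentrated_pair_prob[OF assms(2-)] by simp
  finally have "measure_pmf.prob ?M {I. \<not> robust_uncertainty N (time_set N I) (freq_set N I)} \<le> \<dots>" .
  moreover have "measure_pmf.prob ?M {I. \<not> robust_uncertainty N (time_set N I) (freq_set N I)} =
      1 - measure_pmf.prob ?M {I. robust_uncertainty N (time_set N I) (freq_set N I)}"
    using measure_pmf.prob_compl[of "{I. robust_uncertainty N (time_set N I) (freq_set N I)}" ?M]
    by (simp add: Collect_neg_eq Compl_eq_Diff_UNIV)
  ultimately show ?thesis by linarith
qed

section \<open>Choice of the parameters\<close>

text \<open>
  With \<open>l = (\<beta> + 1) log N\<close> the choices are
  \<open>\<eta> = 1 / l\<^sup>2\<close>, \<open>\<epsilon> = 1 / (2 l)\<close>,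
  \<open>R = 1 / l\<close> and \<open>n\<close> close to \<open>l / 2\<close>. For large
  \<open>N\<close> each of the three error terms is then at most
  \<open>N\<^bsup>-\<beta>\<^esup>\<close>; the factor
  \<open>(1 + R / B\<^sup>2)\<^sup>2\<^sup>n\<close> is bounded by the constant
  \<open>exp (2 / B\<^sup>2)\<close>, which the decay of the probabilities like
  \<open>1 / sqrt l\<close> outweighs.
\<close>
lemma robust_uncertainty_asymptotic:
  fixes \<beta> :: real
  assumes "\<beta> \<ge> 1"
  shows "\<forall>\<^sub>F N in sequentially. \<forall>pT pW. 0 \<le> pT \<longrightarrow> 0 \<le> pW \<longrightarrow>
    pT + pW \<le> 0.4 / sqrt ((\<beta> + 1) * ln (real N)) \<longrightarrow>
    1 - 3 * real N powr (- \<beta>) \<le> measure_pmf.prob (bernoulli_model N pT pW)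
      {I. robust_uncertainty N (time_set N I) (freq_set N I)}"
proof -
  define B :: real where "B = exp (- 1) / 4"
  have "0 < B" by (simp add: B_def)
  \<comment> \<open>Once \<open>K \<le> sqrt l\<close>, the smallness condition of the moment bound holds for every \<open>p \<le> 0.4 / sqrt l\<close>.\<close>
  define K where "K = 0.8 * exp (2 / B\<^sup>2) / B\<^sup>2"
  have "0 < \<beta> + 1" using assms by simp
  then have lim: "filterlim (\<lambda>N. (\<beta> + 1) * ln (real N)) at_top sequentially"
    by real_asymp
  have "((\<lambda>N. 5 * (real N)\<^sup>2 * exp (- real N * (1 / ((\<beta> + 1) * ln (real N))\<^sup>2)\<^sup>2 / 2) * real N powr \<beta>)
      \<longlongrightarrow> 0) sequentially"
    using \<open>0 < \<beta> + 1\<close> by real_asymp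
  then have ev1: "\<forall>\<^sub>F N in sequentially. 5 * (real N)\<^sup>2 *
      exp (- real N * (1 / ((\<beta> + 1) * ln (real N))\<^sup>2)\<^sup>2 / 2) * real N powr \<beta> < 1"
    by (rule order_tendstoD) simp
  have ev2: "\<forall>\<^sub>F N in sequentially. max 16 (K\<^sup>2) \<le> (\<beta> + 1) * ln (real N)"
    using lim unfolding filterlim_at_top by blast
  show ?thesis
    using eventually_gt_at_top[of 0] ev1 ev2
  proof (eventually_elim, intro allI impI)
    fix N :: nat and pT pW :: real
    define l where "l = (\<beta> + 1) * ln (real N)"
    assume N: "0 < N" and decay: "5 * (real N)\<^sup>2 *
      exp (- real N * (1 / ((\<beta> + 1) * ln (real N))\<^sup>2)\<^sup>2 / 2) * real N powr \<beta> < 1"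
      and "max 16 (K\<^sup>2) \<le> (\<beta> + 1) * ln (real N)"
      and p: "0 \<le> pT" "0 \<le> pW" "pT + pW \<le> 0.4 / sqrt ((\<beta> + 1) * ln (real N))"
    then have l: "16 \<le> l" "K\<^sup>2 \<le> l" by (simp_all add: l_def)
    then have "0 < l" by simp
    have sqrt_l: "4 \<le> sqrt l" "K \<le> sqrt l"
      using l real_sqrt_le_mono[of 16 l] by (auto intro: real_le_rsqrt)
    have p_le: "pT \<le> 0.4 / sqrt l" "pW \<le> 0.4 / sqrt l" using p by (simp_all add: l_def)
    have "0.4 / sqrt l \<le> 0.4 / 4" using sqrt_l \<open>0 < l\<close> by (intro divide_left_mono) auto
    then have p_small: "pT \<le> 0.1" "pW \<le> 0.1" using p_le by simp_all
    define n where "n = nat \<lceil>l / 2\<rceil>"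
    have n: "l \<le> 2 * real n" "2 * real n \<le> 2 * l"
      using \<open>16 \<le> l\<close> unfolding n_def by linarith+
    define \<eta> where "\<eta> = 1 / l\<^sup>2"
    define \<epsilon> where "\<epsilon> = 1 / (2 * l)"
    have "\<eta> \<le> 1 / 16 * (1 / l)"
      unfolding \<eta>_def using l(1) by (simp add: power2_eq_square divide_simps)
    have "1 / l \<le> 1 / 16" using l(1) by (simp add: divide_simps)
    have "pT * pW \<le> (0.4 / sqrt l) * (0.4 / sqrt l)"
      using p p_le \<open>0 < l\<close> by (intro mult_mono) auto
    also have "\<dots> = 4 / 25 * (1 / l)" using \<open>0 < l\<close> by simp
    finally have "pT * pW \<le> 4 / 25 * (1 / l)" .
    moreover have "pT * \<eta> \<le> 1 * \<eta>"
      using p_small by (intro mult_right_mono) (simp_all add: \<eta>_def)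
    moreover have "\<epsilon> = 1 / 2 * (1 / l)" by (simp add: \<epsilon>_def)
    moreover have "0 < 1 / l" using \<open>0 < l\<close> by simp
    ultimately have R: "pT * (pW + \<eta>) + \<epsilon> \<le> 1 / l"
      using \<open>\<eta> \<le> 1 / 16 * (1 / l)\<close> unfolding distrib_left by linarith
    have small: "2 * pT * (1 + (1 / l) / B\<^sup>2) ^ (2 * n) \<le> B\<^sup>2"
    proof -
      have "(1 + (1 / l) / B\<^sup>2) ^ (2 * n) \<le> exp ((1 / l) / B\<^sup>2) ^ (2 * n)"
        using \<open>0 < l\<close> by (intro power_mono exp_ge_add_one_self) simp
      also have "\<dots> = exp (2 * real n * ((1 / l) / B\<^sup>2))"
        by (simp flip: exp_of_nat_mult)
      also have "\<dots> \<le> exp (2 * l * ((1 / l) / B\<^sup>2))"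
        using n \<open>0 < l\<close> by (intro iffD2[OF exp_le_cancel_iff] mult_right_mono) auto
      also have "2 * l * ((1 / l) / B\<^sup>2) = 2 / B\<^sup>2" using \<open>0 < l\<close> by simp
      finally have "2 * pT * (1 + (1 / l) / B\<^sup>2) ^ (2 * n) \<le> 2 * (0.4 / sqrt l) * exp (2 / B\<^sup>2)"
        using p p_le \<open>0 < l\<close> by (intro mult_mono) auto
      also have "\<dots> = B\<^sup>2 * (K / sqrt l)" using \<open>0 < B\<close> by (simp add: K_def)
      also have "\<dots> \<le> B\<^sup>2 * 1"
        using sqrt_l \<open>0 < l\<close> by (intro mult_left_mono) (auto simp: divide_simps)
      finally show ?thesis by simp
    qed
    have "pW + \<eta> \<le> 1 / 4"
      using p_small \<open>\<eta> \<le> 1 / 16 * (1 / l)\<close> \<open>1 / l \<le> 1 / 16\<close> by linarith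
    moreover have "0 < \<epsilon>" "0 < \<eta>" using \<open>0 < l\<close> by (simp_all add: \<epsilon>_def \<eta>_def)
    ultimately have "1 - (5 * (real N)\<^sup>2 * exp (- real N * \<eta>\<^sup>2 / 2) +
        (N * exp (- 2 * \<epsilon>\<^sup>2 / \<eta>\<^sup>2) + N * exp (- 2 * real n)))
      \<le> measure_pmf.prob (bernoulli_model N pT pW)
          {I. robust_uncertainty N (time_set N I) (freq_set N I)}"
      using N p p_small R small[unfolded B_def]
      by (intro robust_uncertainty_prob[where R = "1 / l"]) simp_all
    moreover have "5 * (real N)\<^sup>2 * exp (- real N * \<eta>\<^sup>2 / 2) \<le> real N powr (- \<beta>)"
      using decay N by (simp add: \<eta>_def l_def powr_minus field_simps)
    moreover have N_exp: "N * exp (- l) = real N powr (- \<beta>)"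
      using N by (simp add: l_def powr_def algebra_simps exp_diff exp_minus exp_add inverse_eq_divide)
    moreover have "N * exp (- 2 * \<epsilon>\<^sup>2 / \<eta>\<^sup>2) \<le> N * exp (- l)"
    proof -
      have "2 * \<epsilon>\<^sup>2 / \<eta>\<^sup>2 = l\<^sup>2 / 2"
        using \<open>0 < l\<close> by (simp add: \<epsilon>_def \<eta>_def power2_eq_square)
      moreover have "l \<le> l\<^sup>2 / 2" using l by (simp add: power2_eq_square)
      ultimately show ?thesis by (intro mult_left_mono) auto
    qed
    moreover have "N * exp (- 2 * real n) \<le> N * exp (- l)"
      using n by (intro mult_left_mono) auto
    ultimately show "1 - 3 * real N powr (- \<beta>) \<le> measure_pmf.prob (bernoulli_model N pT pW)
        {I. robust_uncertainty N (time_set N I) (freq_set N I)}"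
      by linarith
  qed
qed

text \<open>
  Below the threshold \<open>N0\<close> of the asymptotic bound the claim is vacuous, because
  \<open>C \<ge> N0\<^bsup>\<beta>\<^esup>\<close> and \<open>ln N \<ge> 1\<close>.
\<close>
lemma robust_uncertainty_all_sizes:
  fixes \<beta> :: real
  assumes "\<beta> \<ge> 1"
  obtains C where "0 < C" and "\<And>N pT pW. N \<ge> 512 \<Longrightarrow> 0 \<le> pT \<Longrightarrow> 0 \<le> pW \<Longrightarrow>
    pT + pW \<le> 0.4 / sqrt ((\<beta> + 1) * ln (real N)) \<Longrightarrow>
    1 - C * ln (real N) * real N powr (- \<beta>) \<le> measure_pmf.prob (bernoulli_model N pT pW)
      {I. robust_uncertainty N (time_set N I) (freq_set N I)}"
proof -
  obtain N0 where N0: "1 - 3 * real N powr (- \<beta>) \<le> measure_pmf.prob (bernoulli_model N pT pW)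
      {I. robust_uncertainty N (time_set N I) (freq_set N I)}"
    if "N \<ge> N0" "0 \<le> pT" "0 \<le> pW" "pT + pW \<le> 0.4 / sqrt ((\<beta> + 1) * ln (real N))" for N pT pW
    using robust_uncertainty_asymptotic[OF assms] unfolding eventually_sequentially by blast
  define C where "C = max 3 (real N0 powr \<beta>)"
  have "1 - C * ln (real N) * real N powr (- \<beta>) \<le> measure_pmf.prob (bernoulli_model N pT pW)
      {I. robust_uncertainty N (time_set N I) (freq_set N I)}" (is "_ \<le> ?P")
    if "N \<ge> 512" "0 \<le> pT" "0 \<le> pW" "pT + pW \<le> 0.4 / sqrt ((\<beta> + 1) * ln (real N))" for N pT pW
  proof -
    have "exp 1 \<le> real N" using exp_le that(1) by linarith
    then have "1 \<le> ln (real N)" using that(1) by (subst ln_ge_iff) auto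
    then have C_ln: "C \<le> C * ln (real N)"
      by (simp add: C_def mult_le_cancel_left1)
    show ?thesis
    proof (cases "N \<ge> N0")
      case True
      have "3 * real N powr (- \<beta>) \<le> C * ln (real N) * real N powr (- \<beta>)"
        using C_ln by (intro mult_right_mono) (auto simp: C_def)
      then show ?thesis using N0[OF True that(2-)] by linarith
    next
      case False
      have "1 = real N powr \<beta> * real N powr (- \<beta>)"
        using that(1) by (simp flip: powr_add)
      also have "\<dots> \<le> (C * ln (real N)) * real N powr (- \<beta>)"
      proof (rule mult_right_mono)
        have "real N powr \<beta> \<le> real N0 powr \<beta>"
          using False assms by (intro powr_mono2) auto
        then show "real N powr \<beta> \<le> C * ln (real N)" using C_ln by (simp add: C_def)
      qed simp
      finally have "1 - C * ln (real N) * real N powr (- \<beta>) \<le> 0" by simp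
      also have "0 \<le> ?P" by simp
      finally show ?thesis .
    qed
  qed
  then show thesis using that[of C] by (simp add: C_def)
qed

theorem theorem3p1:
  fixes \<beta> :: real
  assumes "\<beta> \<ge> 1"
  shows "\<exists>(\<epsilon> :: nat \<Rightarrow> real) (C :: real). \<epsilon> \<longlonglongrightarrow> 0 \<and> C > 0 \<and>
    (\<forall>(N::nat) (pT::real) (pW::real).
       let ET = expected_time_size N pT pW; EW = expected_freq_size N pT pW in
       N \<ge> 512 \<longrightarrow> 0 \<le> pT \<longrightarrow> pT \<le> 1 \<longrightarrow> 0 \<le> pW \<longrightarrow> pW \<le> 1 \<longrightarrow>
       min ET EW \<ge> 4 * (\<beta> + 1) * ln (real N) \<longrightarrow>
       2 * sqrt (ET * EW) \<le> ET + EW \<longrightarrow>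
       ET + EW \<le> real N / sqrt ((\<beta> + 1) * ln (real N)) * (0.7614 / 2 + \<epsilon> N) \<longrightarrow>
       measure_pmf.prob (bernoulli_model N pT pW)
         {I. robust_uncertainty N (time_set N I) (freq_set N I)}
         \<ge> 1 - C * ln (real N) * real N powr (- \<beta>)) \<and>
    (\<forall>(N::nat) (pT::real) (pW::real).
       let ET = expected_time_size N pT pW; EW = expected_freq_size N pT pW in
       N \<ge> 512 \<longrightarrow> 0 \<le> pT \<longrightarrow> pT \<le> 1 \<longrightarrow> 0 \<le> pW \<longrightarrow> pW \<le> 1 \<longrightarrow>
       min ET EW \<ge> 4 * (\<beta> + 1) * ln (real N) \<longrightarrow>
       2 * sqrt (ET * EW) \<le> ET + EW \<longrightarrow>
       ET + EW \<le> 0.2660 * real N / sqrt ((\<beta> + 1) * ln (real N)) \<longrightarrow>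
       measure_pmf.prob (bernoulli_model N pT pW)
         {I. robust_uncertainty N (time_set N I) (freq_set N I)}
         \<ge> 1 - C * ln (real N) * real N powr (- \<beta>))"
proof -
  obtain C where "0 < C" and C: "\<And>N pT pW. N \<ge> 512 \<Longrightarrow> 0 \<le> pT \<Longrightarrow> 0 \<le> pW \<Longrightarrow>
    pT + pW \<le> 0.4 / sqrt ((\<beta> + 1) * ln (real N)) \<Longrightarrow>
    1 - C * ln (real N) * real N powr (- \<beta>) \<le> measure_pmf.prob (bernoulli_model N pT pW)
      {I. robust_uncertainty N (time_set N I) (freq_set N I)}"
    using robust_uncertainty_all_sizes[OF assms] by blast
  have bound: "1 - C * ln (real N) * real N powr (- \<beta>) \<le> measure_pmf.prob (bernoulli_model N pT pW)
      {I. robust_uncertainty N (time_set N I) (freq_set N I)}"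
    if "N \<ge> 512" "0 \<le> pT" "pT \<le> 1" "0 \<le> pW" "pW \<le> 1" "c \<le> 0.4"
      and sizes: "expected_time_size N pT pW + expected_freq_size N pT pW
        \<le> real N * (c / sqrt ((\<beta> + 1) * ln (real N)))" for N pT pW c
  proof (rule C)
    have "real N * (pT + pW) \<le> real N * (c / sqrt ((\<beta> + 1) * ln (real N)))"
      using sizes that by (simp only: expected_time_size_eq expected_freq_size_eq distrib_left mult.commute)
    then have "pT + pW \<le> c / sqrt ((\<beta> + 1) * ln (real N))"
      using \<open>N \<ge> 512\<close> by (subst (asm) mult_le_cancel_left_pos) auto
    also have "\<dots> \<le> 0.4 / sqrt ((\<beta> + 1) * ln (real N))"
      using that assms by (intro divide_right_mono) auto
    finally show "pT + pW \<le> 0.4 / sqrt ((\<beta> + 1) * ln (real N))" .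
  qed (use that in auto)
  show ?thesis
  proof (intro exI[of _ "\<lambda>_. 0"] exI[of _ C] conjI allI)
    fix N :: nat and pT pW :: real
    show "let ET = expected_time_size N pT pW; EW = expected_freq_size N pT pW in
       N \<ge> 512 \<longrightarrow> 0 \<le> pT \<longrightarrow> pT \<le> 1 \<longrightarrow> 0 \<le> pW \<longrightarrow> pW \<le> 1 \<longrightarrow>
       min ET EW \<ge> 4 * (\<beta> + 1) * ln (real N) \<longrightarrow>
       2 * sqrt (ET * EW) \<le> ET + EW \<longrightarrow>
       ET + EW \<le> real N / sqrt ((\<beta> + 1) * ln (real N)) * (0.7614 / 2 + 0) \<longrightarrow>
       measure_pmf.prob (bernoulli_model N pT pW)
         {I. robust_uncertainty N (time_set N I) (freq_set N I)}
         \<ge> 1 - C * ln (real N) * real N powr (- \<beta>)"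
      unfolding Let_def by (intro impI bound[where c = "0.7614 / 2"]) simp_all
    show "let ET = expected_time_size N pT pW; EW = expected_freq_size N pT pW in
       N \<ge> 512 \<longrightarrow> 0 \<le> pT \<longrightarrow> pT \<le> 1 \<longrightarrow> 0 \<le> pW \<longrightarrow> pW \<le> 1 \<longrightarrow>
       min ET EW \<ge> 4 * (\<beta> + 1) * ln (real N) \<longrightarrow>
       2 * sqrt (ET * EW) \<le> ET + EW \<longrightarrow>
       ET + EW \<le> 0.2660 * real N / sqrt ((\<beta> + 1) * ln (real N)) \<longrightarrow>
       measure_pmf.prob (bernoulli_model N pT pW)
         {I. robust_uncertainty N (time_set N I) (freq_set N I)}
         \<ge> 1 - C * ln (real N) * real N powr (- \<beta>)"
      unfolding Let_def by (intro impI bound[where c = "0.2660"]) (simp_all add: mult.commute)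
  qed (simp_all add: \<open>0 < C\<close>)
qed

end
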